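(* Consider the finite memory change-point model with $\kappa\ge0$ fixed, with $\Psi=\Psi_\alpha$ and $\pi_0$ allowed to depend on $\alpha\in(0,1)$, and assume that there is a constant $c\in(0,1)$ such that $\sup_{t\ge0,z\in[K]^t}\pi_t(z;\alpha)\le1-c$ for all small enough $\alpha$. Let $z_0^*,\Xi_1^*,\Xi_2^*$ be the optimal choices defined in the context. Then: (a) with $\lambda^*=\inf_{\mathcal X}\mathsf E[\Theta_{\mathcal X}]$ (infimum over all assignment rules), $\lambda^*=\lambda(z_0^*,\Xi_1^* )$ and $\alpha\,\widetilde\lambda(\Xi_1^* )=o(\lambda^*+|\log\alpha|)$ as $\alpha\to0$; (b) with $\mathsf D^*=\mathsf D(\Xi_2^* )$, one has $\mathsf D^*=O(1)$ and, for every $\epsilon\in(0,1)$, with $N_{\epsilon,\alpha}=\lfloor(1-\epsilon)|\log\alpha|/\mathsf D^*\rfloor$, $$\limsup_{\alpha\to0}\ \sup_{t\ge0,\,\mathcal X}\ \frac1{\mathsf D^*N_{\epsilon,\alpha}}\sum_{s=1}^{N_{\epsilon,\alpha}}\big(I_{X_{t+s}}+\omega(\Pi_{t+s}(\mathcal X))\big)\le1+\epsilon/2,$$ the supremum being over all assignment rules $\mathcal X=\{X_t\}$.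
   Context: Setup. Fix $2\le K<\infty$, $[K]=\{1,\dots,K\}$, $\mathbb N=\{1,2,\dots\}$. There is a latent process $L_t\in\{0,1\}$, $t\ge0$, with $L_t=0$ for $t<\Theta$ and $L_t=1$ for $t\ge\Theta$ ($\Theta=\Theta_{\mathcal X}$ is the change-point). At each $t\in\mathbb N$ a treatment $X_t\in[K]$ is selected and a response $Y_t$ in a Polish space $\mathbb Y$ is observed; $\mathcal F_t=\sigma(X_s,Y_s:1\le s\le t)$, $\mathcal F_0$ trivial. An assignment rule $\mathcal X=\{X_t\}$ has $X_1$ deterministic and $X_t$ a measurable function of $X_1,\dots,X_{t-1},Y_1,\dots,Y_{t-1}$. Response model (not depending on $\alpha$): for each $x\in[K]$, $f_x,g_x$ are densities with respect to a $\sigma$-finite measure $\mu$ on $\mathbb Y$; given $X_t=x,L_t=i,\mathcal F_{t-1},L_0,\dots,L_{t-1}$, $Y_t$ has density $f_x$ if $i=0$, $g_x$ if $i=1$; $I_x=\int\log(g_x/f_x)g_x\,d\mu\in(0,\infty)$. Change-point model: $\mathsf P(L_0=1)=\pi_0\in[0,1)$, $\mathsf P(L_t=1\mid L_{t-1}=0,\mathcal F_{t-1},X_t)=\Pi_t=\Pi_t(\mathcal X)=\pi_t(X_1,\dots,X_t)$. Finite memory model: $\Pi_t=\Psi(X_t,\mathbb S_{t-1})$ with $\mathbb S_t=\Phi(X_t,\mathbb S_{t-1})$, $\Phi(x,(x_\kappa,\dots,x_1))=(x,x_\kappa,\dots,x_2)$, for a given initial state $\mathbb S_0\in[K]^\kappa$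 and $\Psi:[K]\times[K]^\kappa\to[0,1)$. So $\pi_t(x_1,\dots,x_t)=\Psi(x_t,x_{t-1},\dots,x_{t-\kappa})$, entries with non-positive index being taken from $\mathbb S_0$. A block of length $\ell$ is $\Xi\in[K]^\ell$, extended cyclically: $\Xi(j\ell+i)=\Xi(i)$; $\Xi(1:s)=(\Xi(1),\dots,\Xi(s))$; $z_0(1:s)$ is the first $s$ entries of $z_0$. $\omega(x)=|\log(1-x)|$; $I(\Xi)=\frac1\ell\sum_{i=1}^\ell I_{\Xi(i)}$; $d(\Xi)=\frac1\ell\sum_{j=1}^\ell\omega(\Psi(\Xi(j),\Xi(j-1),\dots,\Xi(j-\kappa)))$; $\mathsf D(\Xi)=I(\Xi)+d(\Xi)$; $\widetilde\lambda(\Xi)=\sup_{m\ge0,z\in[K]^m}\{1+\sum_{t\ge1}\prod_{s=1}^t(1-\pi_{m+s}(z,\Xi(1:s)))\}$; for $z_0\in[K]^{t_0}$, $$\lambda(z_0,\Xi)=(1-\pi_0)\Big[1+\sum_{t=1}^{t_0}\prod_{s=1}^t(1-\pi_s(z_0(1:s)))+\sum_{t=t_0+1}^\infty\prod_{s=1}^{t_0}(1-\pi_s(z_0(1:s)))\prod_{s=t_0+1}^t(1-\pi_s(z_0,\Xi(1:s-t_0)))\Big].$$ Optimal $z_0^*,\Xi_1^*$. Let $V^*(\mathbb S)=\inf_{(x_1,x_2,\dots)\in[K]^\infty}\sum_{t\ge1}\prod_{s=1}^t(1-\Psi(x_s,\mathbb S_{s-1}))$ with $\mathbb S_0=\mathbb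 S$, $\mathbb S_t=\Phi(x_t,\mathbb S_{t-1})$; $\upsilon^*(\mathbb S)\in\arg\min_{x\in[K]}(1-\Psi(x,\mathbb S))(1+V^*(\Phi(x,\mathbb S)))$. Starting from the model's initial state $\mathbb S_0^*=\mathbb S_0$, let $x_t^*=\upsilon^*(\mathbb S_{t-1}^* )$, $\mathbb S_t^*=\Phi(x_t^*,\mathbb S_{t-1}^* )$; $u^*=\inf\{t\ge1:\mathbb S_t^*=\mathbb S_\ell^*\text{ for some }0\le\ell<t\}$, $\ell^*\in[0,u^* )$ the integer with $\mathbb S^*_{\ell^*}=\mathbb S^*_{u^*}$; $z_0^*=(x_1^*,\dots,x_{\ell^*}^* )$, $\Xi_1^*=(x^*_{\ell^*+1},\dots,x^*_{u^*})$. Optimal $\Xi_2^*$. Let $r(x,\mathbb S)=I_x+\omega(\Psi(x,\mathbb S))$, and let $\lambda'\in\mathbb R$, $h':[K]^\kappa\to\mathbb R$ solve $\lambda'+h'(\mathbb S)=\max_{x\in[K]}[r(x,\mathbb S)+h'(\Phi(x,\mathbb S))]$ for all $\mathbb S\in[K]^\kappa$; $\upsilon'(\mathbb S)\in\arg\max_x[r(x,\mathbb S)+h'(\Phi(x,\mathbb S))]$. With $\mathbb S_0'=\mathbb S_0$, $x_t'=\upsilon'(\mathbb S_{t-1}')$, $\mathbb S_t'=\Phi(x_t',\mathbb S_{t-1}')$, let $u'=\inf\{t\ge1:\mathbb S_t'=\mathbb S_\ell'\text{ for some }0\le\ell<t\}$, $\ell'\in[0,u')$ with $\mathbb S'_{\ell'}=\mathbb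 S'_{u'}$, and $\Xi_2^*=(x'_{\ell'+1},\dots,x'_{u'})$. Asymptotic notation (limits as $\alpha\to0$): $x=o(y)$ if $x/y\to0$; $x=O(y)$ if $\limsup x/y<\infty$. *)

theory Defs
  imports "HOL-Probability.Probability" "HOL-Library.Landau_Symbols"
begin

section \<open>Responses\<close>

definition info :: "'y measure \<Rightarrow> (nat \<Rightarrow> 'y \<Rightarrow> real) \<Rightarrow> (nat \<Rightarrow> 'y \<Rightarrow> real) \<Rightarrow> nat \<Rightarrow> real" where
  "info \<mu> f g x = (\<integral>y. ln (g x y / f x y) * g x y \<partial>\<mu>)"

text \<open>
  The condition \<open>I\<^sub>x \<in> (0,\<infinity>)\<close> is spelled out because \<open>ln 0 = 0\<close> and because the Bochner
  integral of a non-integrable function is \<open>0\<close> here. Where \<open>f\<^sub>x = 0 < g\<^sub>x\<close> the integrand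
  \<open>log (g\<^sub>x / f\<^sub>x) g\<^sub>x\<close> equals \<open>+\<infinity>\<close>, and its negative part is always integrable, so
  \<open>I\<^sub>x < \<infinity>\<close> means exactly \<open>finite_info_ac\<close> together with \<open>finite_info_int\<close>.
\<close>

locale response_model =
  fixes K :: nat and \<mu> :: "'y::polish_space measure" and f g :: "nat \<Rightarrow> 'y \<Rightarrow> real"
  assumes base_sets: "sets \<mu> = sets borel"
    and base_sigma_finite: "sigma_finite_measure \<mu>"
    and density_f: "\<And>x. x \<in> {1..K} \<Longrightarrow>
      f x \<in> borel_measurable \<mu> \<and> (\<forall>y. 0 \<le> f x y) \<and> integrable \<mu> (f x) \<and> (\<integral>y. f x y \<partial>\<mu>) = 1"
    and density_g: "\<And>x. x \<in> {1..K} \<Longrightarrow>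
      g x \<in> borel_measurable \<mu> \<and> (\<forall>y. 0 \<le> g x y) \<and> integrable \<mu> (g x) \<and> (\<integral>y. g x y \<partial>\<mu>) = 1"
    and finite_info_ac: "\<And>x. x \<in> {1..K} \<Longrightarrow> AE y in \<mu>. f x y = 0 \<longrightarrow> g x y = 0"
    and finite_info_int: "\<And>x. x \<in> {1..K} \<Longrightarrow> integrable \<mu> (\<lambda>y. ln (g x y / f x y) * g x y)"
    and info_pos: "\<And>x. x \<in> {1..K} \<Longrightarrow> 0 < info \<mu> f g x"

section \<open>Assignment rules\<close>

text \<open>
  A rule \<open>\<X>\<close> gives \<open>X\<^sub>t = \<X> t [X\<^sub>1, \<dots>, X\<^sub>t\<^sub>-\<^sub>1] (Y\<^sub>s)\<^sub>1\<^sub>\<le>\<^sub>s\<^sub><\<^sub>t\<close> for \<open>t \<ge> 1\<close>. The response history is an element of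
  the product over \<open>{1..<t}\<close>, which for \<open>t = 1\<close> is a one-point space, so that \<open>X\<^sub>1\<close> is deterministic.
\<close>

type_synonym 'y rule = "nat \<Rightarrow> nat list \<Rightarrow> (nat \<Rightarrow> 'y) \<Rightarrow> nat"

definition rules :: "nat \<Rightarrow> 'y::topological_space rule set" where
  "rules K = {\<X>. \<forall>t\<ge>1. \<forall>xs\<in>lists {1..K}. length xs = t - 1 \<longrightarrow>
      \<X> t xs \<in> (\<Pi>\<^sub>M s\<in>{1..<t}. borel) \<rightarrow>\<^sub>M count_space {1..K}}"

text \<open>The list \<open>[X\<^sub>1, \<dots>, X\<^sub>t]\<close> produced by a rule on the response path \<open>y\<close>.\<close>

primrec treatments :: "'y rule \<Rightarrow> (nat \<Rightarrow> 'y) \<Rightarrow> nat \<Rightarrow> nat list" where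
  "treatments \<X> y 0 = []"
| "treatments \<X> y (Suc t) =
     treatments \<X> y t @ [\<X> (Suc t) (treatments \<X> y t) (restrict y {1..<Suc t})]"

definition treatment :: "'y rule \<Rightarrow> (nat \<Rightarrow> 'y) \<Rightarrow> nat \<Rightarrow> nat" where
  "treatment \<X> y t = treatments \<X> y t ! (t - 1)"

section \<open>The change-point process under an assignment rule\<close>

text \<open>\<open>\<sigma>(X\<^sub>1, \<dots>, X\<^sub>t, Y\<^sub>1, \<dots>, Y\<^sub>t\<^sub>-\<^sub>1, L\<^sub>s : s \<in> J)\<close>\<close>

definition past :: "'w measure \<Rightarrow> (nat \<Rightarrow> 'w \<Rightarrow> nat) \<Rightarrow> (nat \<Rightarrow> 'w \<Rightarrow> 'y::topological_space)
    \<Rightarrow> (nat \<Rightarrow> 'w \<Rightarrow> nat) \<Rightarrow> nat \<Rightarrow> nat set \<Rightarrow> 'w measure" where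
  "past M X Y L t J = sigma (space M)
     ({X s -` {x} \<inter> space M | s x. 1 \<le> s \<and> s \<le> t} \<union>
      {Y s -` B \<inter> space M | s B. 1 \<le> s \<and> s < t \<and> B \<in> sets borel} \<union>
      {L s -` {i} \<inter> space M | s i. s \<in> J})"

text \<open>
  The change-point model is given by a function \<open>\<pi>\<close> on finite treatment sequences (in chronological
  order): \<open>\<pi> []\<close> is \<open>\<pi>\<^sub>0\<close> and \<open>\<pi> [x\<^sub>1, \<dots>, x\<^sub>t]\<close> is \<open>\<pi>\<^sub>t(x\<^sub>1, \<dots>, x\<^sub>t)\<close>. The change-point \<open>\<Theta>\<close> may be infinite.
\<close>

locale changepoint_process =
  fixes \<mu> :: "'y::polish_space measure" and f g :: "nat \<Rightarrow> 'y \<Rightarrow> real"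
    and \<pi> :: "nat list \<Rightarrow> real" and \<X> :: "'y rule"
    and M :: "'w measure" and \<Theta> :: "'w \<Rightarrow> enat" and Y :: "nat \<Rightarrow> 'w \<Rightarrow> 'y"
  fixes X L :: "nat \<Rightarrow> 'w \<Rightarrow> nat"
  defines "X \<equiv> \<lambda>t w. treatment \<X> (\<lambda>s. Y s w) t"
    and "L \<equiv> \<lambda>t w. if enat t < \<Theta> w then 0 else 1"
  assumes prob_space: "prob_space M"
    and Theta_measurable: "\<Theta> \<in> M \<rightarrow>\<^sub>M count_space UNIV"
    and Y_measurable: "\<And>t. 1 \<le> t \<Longrightarrow> Y t \<in> M \<rightarrow>\<^sub>M borel"
    and initial: "measure M {w \<in> space M. L 0 w = 1} = \<pi> []"
    and transition: "\<And>t. 1 \<le> t \<Longrightarrow> AE w in M. L (t - 1) w = 0 \<longrightarrow>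
      real_cond_exp M (past M X Y L t {t - 1}) (indicator {w \<in> space M. L t w = 1}) w
        = \<pi> (treatments \<X> (\<lambda>s. Y s w) t)"
    and response: "\<And>t B. 1 \<le> t \<Longrightarrow> B \<in> sets borel \<Longrightarrow> AE w in M.
      real_cond_exp M (past M X Y L t {0..t}) (indicator {w \<in> space M. Y t w \<in> B}) w
        = (LINT y:B|\<mu>. (if L t w = 0 then f (X t w) y else g (X t w) y))"

definition mean_change :: "'w measure \<Rightarrow> ('w \<Rightarrow> enat) \<Rightarrow> ennreal" where
  "mean_change M \<Theta> = (\<integral>\<^sup>+ w. ennreal_of_enat (\<Theta> w) \<partial>M)"

section \<open>Finite memory\<close>

text \<open>
  States are lists of length \<open>\<kappa>\<close>, most recent treatment first; \<open>take\<close> drops the oldest entry and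
  also gives the right (trivial) update for \<open>\<kappa> = 0\<close>.
\<close>

definition states :: "nat \<Rightarrow> nat \<Rightarrow> nat list set" where
  "states K \<kappa> = {S \<in> lists {1..K}. length S = \<kappa>}"

definition update :: "nat \<Rightarrow> nat \<Rightarrow> nat list \<Rightarrow> nat list" where
  "update \<kappa> x S = take \<kappa> (x # S)"

definition state_after :: "nat \<Rightarrow> nat list \<Rightarrow> nat list \<Rightarrow> nat list" where
  "state_after \<kappa> S0 z = foldl (\<lambda>S x. update \<kappa> x S) S0 z"

definition fm_hazard :: "nat \<Rightarrow> (nat \<Rightarrow> nat list \<Rightarrow> real) \<Rightarrow> nat list \<Rightarrow> real \<Rightarrow> nat list \<Rightarrow> real" where
  "fm_hazard \<kappa> \<Psi> S0 p0 z = (if z = [] then p0 else \<Psi> (last z) (state_after \<kappa> S0 (butlast z)))"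

section \<open>Blocks\<close>

definition cyc :: "nat list \<Rightarrow> int \<Rightarrow> nat" where
  "cyc \<Xi> i = \<Xi> ! nat ((i - 1) mod int (length \<Xi>))"

text \<open>\<open>\<Xi>(1:s)\<close> for the cyclic extension of \<open>\<Xi>\<close>\<close>

definition block_prefix :: "nat list \<Rightarrow> nat \<Rightarrow> nat list" where
  "block_prefix \<Xi> s = map (\<lambda>i. cyc \<Xi> (int i)) [1..<Suc s]"

definition omega :: "real \<Rightarrow> real" where
  "omega x = \<bar>ln (1 - x)\<bar>"

definition block_info :: "(nat \<Rightarrow> real) \<Rightarrow> nat list \<Rightarrow> real" where
  "block_info I \<Xi> = 1 / real (length \<Xi>) * (\<Sum>i=1..length \<Xi>. I (cyc \<Xi> (int i)))"

definition block_drift :: "nat \<Rightarrow> (nat \<Rightarrow> nat list \<Rightarrow> real) \<Rightarrow> nat list \<Rightarrow> real" where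
  "block_drift \<kappa> \<Psi> \<Xi> = 1 / real (length \<Xi>) * (\<Sum>j=1..length \<Xi>.
     omega (\<Psi> (cyc \<Xi> (int j)) (map (\<lambda>i. cyc \<Xi> (int j - int i)) [1..<Suc \<kappa>])))"

definition block_D :: "(nat \<Rightarrow> real) \<Rightarrow> nat \<Rightarrow> (nat \<Rightarrow> nat list \<Rightarrow> real) \<Rightarrow> nat list \<Rightarrow> real" where
  "block_D I \<kappa> \<Psi> \<Xi> = block_info I \<Xi> + block_drift \<kappa> \<Psi> \<Xi>"

text \<open>\<open>\<lambda>~(\<Xi>)\<close> and \<open>\<lambda>(z\<^sub>0, \<Xi>)\<close>, with values in \<open>[0,\<infinity>]\<close>; both are infinite if, e.g., the hazard vanishes.\<close>

definition lambda_tilde :: "nat \<Rightarrow> (nat list \<Rightarrow> real) \<Rightarrow> nat list \<Rightarrow> ennreal" where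
  "lambda_tilde K \<pi> \<Xi> = (SUP z\<in>lists {1..K}.
     1 + (\<Sum>n. \<Prod>s=1..Suc n. ennreal (1 - \<pi> (z @ block_prefix \<Xi> s))))"

definition lambda :: "(nat list \<Rightarrow> real) \<Rightarrow> nat list \<Rightarrow> nat list \<Rightarrow> ennreal" where
  "lambda \<pi> z0 \<Xi> = (let t0 = length z0 in
     ennreal (1 - \<pi> []) *
       (1 + (\<Sum>t=1..t0. \<Prod>s=1..t. ennreal (1 - \<pi> (take s z0)))
          + (\<Sum>n. (let t = t0 + 1 + n in
              (\<Prod>s=1..t0. ennreal (1 - \<pi> (take s z0))) *
              (\<Prod>s=t0 + 1..t. ennreal (1 - \<pi> (z0 @ block_prefix \<Xi> (s - t0))))))))"

section \<open>Optimal choices\<close>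

primrec open_loop :: "nat \<Rightarrow> nat list \<Rightarrow> (nat \<Rightarrow> nat) \<Rightarrow> nat \<Rightarrow> nat list" where
  "open_loop \<kappa> S x 0 = S"
| "open_loop \<kappa> S x (Suc t) = update \<kappa> (x (Suc t)) (open_loop \<kappa> S x t)"

text \<open>\<open>V\<^sup>*(S)\<close>, the infimum being over sequences \<open>(x\<^sub>1, x\<^sub>2, \<dots>)\<close>; it may be infinite.\<close>

definition opt_value :: "nat \<Rightarrow> nat \<Rightarrow> (nat \<Rightarrow> nat list \<Rightarrow> real) \<Rightarrow> nat list \<Rightarrow> ennreal" where
  "opt_value K \<kappa> \<Psi> S = (INF x\<in>{x. \<forall>s\<ge>1. x s \<in> {1..K}}.
     (\<Sum>n. \<Prod>s=1..Suc n. ennreal (1 - \<Psi> (x s) (open_loop \<kappa> S x (s - 1)))))"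

definition is_min_policy :: "nat \<Rightarrow> nat \<Rightarrow> (nat \<Rightarrow> nat list \<Rightarrow> real) \<Rightarrow> (nat list \<Rightarrow> nat) \<Rightarrow> bool" where
  "is_min_policy K \<kappa> \<Psi> \<upsilon> \<longleftrightarrow> (\<forall>S\<in>states K \<kappa>.
     is_arg_min (\<lambda>x. ennreal (1 - \<Psi> x S) * (1 + opt_value K \<kappa> \<Psi> (update \<kappa> x S)))
       (\<lambda>x. x \<in> {1..K}) (\<upsilon> S))"

definition reward :: "(nat \<Rightarrow> real) \<Rightarrow> (nat \<Rightarrow> nat list \<Rightarrow> real) \<Rightarrow> nat \<Rightarrow> nat list \<Rightarrow> real" where
  "reward I \<Psi> x S = I x + omega (\<Psi> x S)"

definition average_reward_eq :: "nat \<Rightarrow> nat \<Rightarrow> (nat \<Rightarrow> real) \<Rightarrow> (nat \<Rightarrow> nat list \<Rightarrow> real)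
    \<Rightarrow> real \<Rightarrow> (nat list \<Rightarrow> real) \<Rightarrow> bool" where
  "average_reward_eq K \<kappa> I \<Psi> l h \<longleftrightarrow> (\<forall>S\<in>states K \<kappa>.
     l + h S = Max ((\<lambda>x. reward I \<Psi> x S + h (update \<kappa> x S)) ` {1..K}))"

definition is_max_policy :: "nat \<Rightarrow> nat \<Rightarrow> (nat \<Rightarrow> real) \<Rightarrow> (nat \<Rightarrow> nat list \<Rightarrow> real)
    \<Rightarrow> (nat list \<Rightarrow> real) \<Rightarrow> (nat list \<Rightarrow> nat) \<Rightarrow> bool" where
  "is_max_policy K \<kappa> I \<Psi> h \<upsilon> \<longleftrightarrow> (\<forall>S\<in>states K \<kappa>.
     is_arg_max (\<lambda>x. reward I \<Psi> x S + h (update \<kappa> x S)) (\<lambda>x. x \<in> {1..K}) (\<upsilon> S))"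

text \<open>
  The states \<open>S\<^sub>t\<close> under a stationary policy \<open>\<upsilon>\<close>, the treatments \<open>x\<^sub>t = \<upsilon>(S\<^sub>t\<^sub>-\<^sub>1)\<close>, the first time
  \<open>u \<ge> 1\<close> at which a state is repeated, and the time \<open>\<ell> < u\<close> of its earlier occurrence.
\<close>

primrec closed_loop :: "nat \<Rightarrow> (nat list \<Rightarrow> nat) \<Rightarrow> nat list \<Rightarrow> nat \<Rightarrow> nat list" where
  "closed_loop \<kappa> \<upsilon> S0 0 = S0"
| "closed_loop \<kappa> \<upsilon> S0 (Suc t) = update \<kappa> (\<upsilon> (closed_loop \<kappa> \<upsilon> S0 t)) (closed_loop \<kappa> \<upsilon> S0 t)"

definition policy_treatment :: "nat \<Rightarrow> (nat list \<Rightarrow> nat) \<Rightarrow> nat list \<Rightarrow> nat \<Rightarrow> nat" where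
  "policy_treatment \<kappa> \<upsilon> S0 t = \<upsilon> (closed_loop \<kappa> \<upsilon> S0 (t - 1))"

definition loop_end :: "(nat \<Rightarrow> nat list) \<Rightarrow> nat" where
  "loop_end S = (LEAST t. 1 \<le> t \<and> (\<exists>l<t. S t = S l))"

definition loop_start :: "(nat \<Rightarrow> nat list) \<Rightarrow> nat" where
  "loop_start S = (THE l. l < loop_end S \<and> S l = S (loop_end S))"

definition policy_init :: "nat \<Rightarrow> (nat list \<Rightarrow> nat) \<Rightarrow> nat list \<Rightarrow> nat list" where
  "policy_init \<kappa> \<upsilon> S0 = map (policy_treatment \<kappa> \<upsilon> S0)
     [1..<Suc (loop_start (closed_loop \<kappa> \<upsilon> S0))]"

definition policy_block :: "nat \<Rightarrow> (nat list \<Rightarrow> nat) \<Rightarrow> nat list \<Rightarrow> nat list" where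
  "policy_block \<kappa> \<upsilon> S0 = map (policy_treatment \<kappa> \<upsilon> S0)
     [loop_start (closed_loop \<kappa> \<upsilon> S0) + 1..<Suc (loop_end (closed_loop \<kappa> \<upsilon> S0))]"

end

theory Submission
  imports Defs
begin

text \<open>
  Given the treatments, each step is survived with probability \<open>1 - \<pi>\<close>, whatever the responses, so
  dynamic programming over finite horizons bounds the mean change time of an arbitrary rule from below.
  As there are finitely many treatments, the limit of the finite-horizon values is attained by a
  deterministic sequence, hence bounded below by \<open>V\<^sup>*\<close>, and the greedy policy for \<open>V\<^sup>*\<close> attains \<open>V\<^sup>*\<close>.
  Its orbit is eventually periodic, which turns its mean change time into \<open>\<lambda>(z\<^sub>0\<^sup>*, \<Xi>\<^sub>1\<^sup>*)\<close>.
  In \<open>\<lambda>~(\<Xi>\<^sub>1\<^sup>*)\<close> the treatments before the block affect only the first \<open>\<kappa>\<close> survival factors, and each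
  factor lies in \<open>[c, 1]\<close>, so \<open>\<lambda>~\<close> is at most a constant times \<open>1 + \<lambda>\<^sup>*\<close>.

  Summing the average reward equation over a period gives \<open>D\<^sup>* = \<lambda>'\<close>. Since every state can be reached
  from every other in \<open>\<kappa>\<close> steps and rewards are nonnegative, \<open>h'\<close> oscillates by at most \<open>\<kappa> \<lambda>'\<close>, so
  that the rewards of any rule over \<open>N\<close> steps add up to at most \<open>(N + \<kappa>) D\<^sup>*\<close>.
\<close>

section \<open>Series of partial products\<close>

definition prod_series :: "(nat \<Rightarrow> ennreal) \<Rightarrow> ennreal" where
  "prod_series c = (\<Sum>n. \<Prod>s=1..Suc n. c s)"

lemma prod_series_cong:
  assumes "\<And>s. 1 \<le> s \<Longrightarrow> c s = d s"
  shows "prod_series c = prod_series d"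
  unfolding prod_series_def using assms by (intro suminf_cong prod.cong) auto

lemma prod_series_shift: "prod_series c = c 1 * (1 + prod_series (\<lambda>s. c (Suc s)))"
proof -
  have head: "(\<Prod>s=1..Suc n. c s) = c 1 * (\<Prod>s=1..n. c (Suc s))" for n
    by (simp add: prod.atLeast_Suc_atMost_Suc_shift prod.atLeast_Suc_atMost[of 0] del: prod.cl_ivl_Suc)
  have "prod_series c = (\<Sum>n. c 1 * (\<Prod>s=1..n. c (Suc s)))"
    unfolding prod_series_def head ..
  also have "\<dots> = c 1 * (\<Sum>n. \<Prod>s=1..n. c (Suc s))"
    by simp
  also have "(\<Sum>n. \<Prod>s=1..n. c (Suc s)) = 1 + prod_series (\<lambda>s. c (Suc s))"
    unfolding prod_series_def by (subst suminf_offset[of _ 1]) (simp_all add: add.commute)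
  finally show ?thesis .
qed

lemma prod_series_split:
  "prod_series c = (\<Sum>t=1..k. \<Prod>s=1..t. c s) + (\<Prod>s=1..k. c s) * prod_series (\<lambda>s. c (k + s))"
proof (induction k)
  case (Suc k)
  have "(\<Prod>s=1..k. c s) * prod_series (\<lambda>s. c (k + s))
      = (\<Prod>s=1..Suc k. c s) * (1 + prod_series (\<lambda>s. c (Suc k + s)))"
    by (subst prod_series_shift) (simp add: mult.assoc)
  then show ?case
    by (subst Suc) (simp add: distrib_left add.assoc)
qed (simp)

text \<open>\<open>v\<close> is a value function along a trajectory with continuation probabilities \<open>c\<close>.\<close>

lemma prod_series_le_value:
  assumes step: "\<And>t. c (Suc t) * (1 + v (Suc t)) \<le> v t"
  shows "prod_series c \<le> v 0"
proof -
  have "(\<Sum>t<n. \<Prod>s=1..Suc t. c s) + (\<Prod>s=1..n. c s) * v n \<le> v 0" for n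
  proof (induction n)
    case (Suc n)
    have "(\<Sum>t<Suc n. \<Prod>s=1..Suc t. c s) + (\<Prod>s=1..Suc n. c s) * v (Suc n)
        = (\<Sum>t<n. \<Prod>s=1..Suc t. c s) + (\<Prod>s=1..n. c s) * (c (Suc n) * (1 + v (Suc n)))"
      by (simp add: distrib_left add.assoc mult.assoc)
    also have "\<dots> \<le> (\<Sum>t<n. \<Prod>s=1..Suc t. c s) + (\<Prod>s=1..n. c s) * v n"
      by (intro add_left_mono mult_left_mono step) simp
    finally show ?case using Suc by (rule order_trans)
  qed simp
  then have "(\<Sum>t<n. \<Prod>s=1..Suc t. c s) \<le> v 0" for n
    using order_trans[OF add_increasing2[OF zero_le order_refl]] by blast
  then show ?thesis
    unfolding prod_series_def by (intro suminf_le_const) auto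
qed

section \<open>The mean change time of a rule\<close>

abbreviation seq_prefix :: "(nat \<Rightarrow> nat) \<Rightarrow> nat \<Rightarrow> nat list" where
  "seq_prefix x t \<equiv> map x [1..<Suc t]"

lemma length_treatments [simp]: "length (treatments \<X> y t) = t"
  by (induction t) simp_all

lemma treatments_seq_prefix: "treatments \<X> y t = seq_prefix (treatment \<X> y) t"
proof (induction t)
  case (Suc t)
  have "treatment \<X> y (Suc t) = \<X> (Suc t) (treatments \<X> y t) (restrict y {1..<Suc t})"
    by (simp add: treatment_def nth_append)
  then show ?case
    using Suc by simp
qed simp

lemma states_snoc: "z @ [x] \<in> states K (Suc t) \<longleftrightarrow> z \<in> states K t \<and> x \<in> {1..K}"
  by (auto simp: states_def)

lemma states_Suc: "states K (Suc t) = (\<lambda>(z, x). z @ [x]) ` (states K t \<times> {1..K})"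
proof (intro subset_antisym subsetI)
  fix z assume "z \<in> states K (Suc t)"
  moreover from this obtain z' x where "z = z' @ [x]"
    by (cases z rule: rev_cases) (auto simp: states_def)
  ultimately show "z \<in> (\<lambda>(z, x). z @ [x]) ` (states K t \<times> {1..K})"
    by (intro image_eqI[of _ _ "(z', x)"]) (simp_all add: states_snoc)
qed (auto simp: states_snoc)

lemma finite_states [simp]: "finite (states K t)"
  using finite_lists_length_eq[of "{1..K}" t] by (simp add: states_def lists_eq_set)

lemma states_0 [simp]: "states K 0 = {[]}"
  by (auto simp: states_def)

lemma rule_measurable:
  assumes "\<X> \<in> rules K" "xs \<in> states K t"
  shows "\<X> (Suc t) xs \<in> (\<Pi>\<^sub>M s\<in>{1..<Suc t}. borel) \<rightarrow>\<^sub>M count_space {1..K}"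
proof -
  have "\<forall>xs\<in>lists {1..K}. length xs = Suc t - 1 \<longrightarrow>
      \<X> (Suc t) xs \<in> (\<Pi>\<^sub>M s\<in>{1..<Suc t}. borel) \<rightarrow>\<^sub>M count_space {1..K}"
    using assms(1) unfolding rules_def mem_Collect_eq by (elim allE[of _ "Suc t"]) simp
  then show ?thesis
    using assms(2) by (simp add: states_def)
qed

lemma rule_value:
  assumes "\<X> \<in> rules K" "xs \<in> states K t"
  shows "\<X> (Suc t) xs (restrict y {1..<Suc t}) \<in> {1..K}"
  using measurable_space[OF rule_measurable[OF assms], of "restrict y {1..<Suc t}"]
  by (simp add: space_PiM)

lemma treatments_in_states:
  assumes "\<X> \<in> rules K"
  shows "treatments \<X> y t \<in> states K t"
proof (induction t)
  case (Suc t)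
  then show ?case
    using rule_value[OF assms Suc] unfolding treatments.simps states_snoc by blast
qed simp

lemma treatment_in:
  assumes "\<X> \<in> rules K" "1 \<le> t"
  shows "treatment \<X> y t \<in> {1..K}"
proof -
  have "treatment \<X> y t \<in> set (treatments \<X> y t)"
    using assms(2) by (simp add: treatment_def)
  moreover have "set (treatments \<X> y t) \<subseteq> {1..K}"
    using treatments_in_states[OF assms(1)] by (simp add: states_def lists_eq_set)
  ultimately show ?thesis by blast
qed

text \<open>The optimal expected number of further steps before the change, over a horizon \<open>n\<close> and after the
  treatments \<open>z\<close>.\<close>

primrec horizon_value :: "nat \<Rightarrow> (nat list \<Rightarrow> real) \<Rightarrow> nat \<Rightarrow> nat list \<Rightarrow> ennreal" where
  "horizon_value K \<pi> 0 z = 0"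
| "horizon_value K \<pi> (Suc n) z =
     (MIN x\<in>{1..K}. ennreal (1 - \<pi> (z @ [x])) * (1 + horizon_value K \<pi> n (z @ [x])))"

lemma horizon_value_Suc_le:
  "x \<in> {1..K} \<Longrightarrow>
    horizon_value K \<pi> (Suc n) z \<le> ennreal (1 - \<pi> (z @ [x])) * (1 + horizon_value K \<pi> n (z @ [x]))"
  by (simp add: Min_le)

lemma horizon_value_Suc_attained:
  assumes "1 \<le> K"
  obtains x where "x \<in> {1..K}"
    "horizon_value K \<pi> (Suc n) z = ennreal (1 - \<pi> (z @ [x])) * (1 + horizon_value K \<pi> n (z @ [x]))"
proof -
  have "horizon_value K \<pi> (Suc n) z
    \<in> (\<lambda>x. ennreal (1 - \<pi> (z @ [x])) * (1 + horizon_value K \<pi> n (z @ [x]))) ` {1..K}"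
    unfolding horizon_value.simps using assms by (intro Min_in) auto
  then show ?thesis using that by blast
qed

lemma horizon_value_le_Suc:
  assumes "1 \<le> K"
  shows "horizon_value K \<pi> n z \<le> horizon_value K \<pi> (Suc n) z"
proof (induction n arbitrary: z)
  case (Suc n)
  obtain x where x: "x \<in> {1..K}" and
    "horizon_value K \<pi> (Suc (Suc n)) z
      = ennreal (1 - \<pi> (z @ [x])) * (1 + horizon_value K \<pi> (Suc n) (z @ [x]))"
    using horizon_value_Suc_attained[OF assms] .
  then have "ennreal (1 - \<pi> (z @ [x])) * (1 + horizon_value K \<pi> n (z @ [x]))
      \<le> horizon_value K \<pi> (Suc (Suc n)) z"
    by (simp only: mult_left_mono[OF add_left_mono[OF Suc]] zero_le)
  then show ?case
    using horizon_value_Suc_le[OF x] order_trans by blast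
qed simp

text \<open>A treatment that is optimal for infinitely many horizons is optimal in the limit.\<close>

lemma limit_value_step:
  assumes K: "1 \<le> K"
  obtains x where "x \<in> {1..K}"
    "ennreal (1 - \<pi> (z @ [x])) * (1 + (SUP n. horizon_value K \<pi> n (z @ [x])))
      \<le> (SUP n. horizon_value K \<pi> n z)"
proof -
  let ?V = "horizon_value K \<pi>"
  have "\<forall>n. \<exists>x. x \<in> {1..K} \<and> ?V (Suc n) z = ennreal (1 - \<pi> (z @ [x])) * (1 + ?V n (z @ [x]))"
    using horizon_value_Suc_attained[OF K] by metis
  then obtain a where a: "\<And>n. a n \<in> {1..K}"
    and opt: "\<And>n. ?V (Suc n) z = ennreal (1 - \<pi> (z @ [a n])) * (1 + ?V n (z @ [a n]))"
    by metis
  have "finite (range a)"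
    using a by (intro finite_subset[of "range a" "{1..K}"]) auto
  then obtain x where "x \<in> range a" and inf: "infinite (a -` {x})"
    using inf_img_fin_dom[of a UNIV] by auto
  have mono: "incseq (\<lambda>n. ?V n z)" for z
    using horizon_value_le_Suc[OF K] by (rule incseq_SucI)
  have "ennreal (1 - \<pi> (z @ [x])) * (1 + ?V m (z @ [x])) \<le> (SUP n. ?V n z)" for m
  proof -
    obtain n where "n \<ge> m" "n \<in> a -` {x}"
      using inf unfolding infinite_nat_iff_unbounded_le by blast
    then have n: "n \<ge> m" "a n = x"
      by simp_all
    have "ennreal (1 - \<pi> (z @ [x])) * (1 + ?V m (z @ [x])) \<le> ?V (Suc n) z"
      unfolding opt n(2) by (intro mult_left_mono add_left_mono incseqD[OF mono] n(1)) simp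
    also have "\<dots> \<le> (SUP n. ?V n z)"
      by (rule SUP_upper) simp
    finally show ?thesis .
  qed
  then have "(SUP m. ennreal (1 - \<pi> (z @ [x])) * (1 + ?V m (z @ [x]))) \<le> (SUP n. ?V n z)"
    by (rule SUP_least)
  also have "(SUP m. ennreal (1 - \<pi> (z @ [x])) * (1 + ?V m (z @ [x])))
      = ennreal (1 - \<pi> (z @ [x])) * (1 + (SUP m. ?V m (z @ [x])))"
    by (simp add: SUP_mult_left_ennreal ennreal_SUP_add_right)
  finally show ?thesis
    using that a \<open>x \<in> range a\<close> by blast
qed

lemma ex_sequence_le_limit_value:
  assumes K: "1 \<le> K"
  obtains x where "\<And>s. x s \<in> {1..K}"
    "prod_series (\<lambda>s. ennreal (1 - \<pi> (seq_prefix x s))) \<le> (SUP n. horizon_value K \<pi> n [])"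
proof -
  let ?V = "\<lambda>z. SUP n. horizon_value K \<pi> n z"
  have "\<forall>z. \<exists>x. x \<in> {1..K} \<and> ennreal (1 - \<pi> (z @ [x])) * (1 + ?V (z @ [x])) \<le> ?V z"
    using limit_value_step[OF K] by metis
  then obtain a where a: "\<And>z. a z \<in> {1..K}"
    and opt: "\<And>z. ennreal (1 - \<pi> (z @ [a z])) * (1 + ?V (z @ [a z])) \<le> ?V z"
    by metis
  define zs where "zs = rec_nat [] (\<lambda>_ z. z @ [a z])"
  define x where "x s = a (zs (s - 1))" for s
  have zs: "seq_prefix x t = zs t" for t
    by (induction t) (simp_all add: zs_def x_def)
  have "prod_series (\<lambda>s. ennreal (1 - \<pi> (seq_prefix x s))) \<le> ?V (zs 0)"
    unfolding zs using opt by (intro prod_series_le_value) (simp add: zs_def)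
  then show ?thesis
    using that[of x] a by (simp add: x_def zs_def)
qed

definition open_loop_rule :: "(nat \<Rightarrow> nat) \<Rightarrow> 'y rule" where
  "open_loop_rule x t zs y = x t"

lemma open_loop_rule_in_rules:
  assumes "\<And>s. 1 \<le> s \<Longrightarrow> x s \<in> {1..K}"
  shows "open_loop_rule x \<in> rules K"
proof -
  have eq: "open_loop_rule x t zs = (\<lambda>_. x t)" for t zs
    by (simp add: open_loop_rule_def fun_eq_iff)
  show ?thesis
    unfolding rules_def eq using assms by auto
qed

lemma treatments_open_loop_rule: "treatments (open_loop_rule x) y t = seq_prefix x t"
  by (induction t) (simp_all add: open_loop_rule_def)

context changepoint_process
begin

definition alive :: "nat \<Rightarrow> nat \<Rightarrow> nat list \<Rightarrow> ennreal" where
  "alive t u z = emeasure M {w \<in> space M. enat t < \<Theta> w \<and> treatments \<X> (\<lambda>s. Y s w) u = z}"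

lemma treatments_sets:
  assumes \<X>: "\<X> \<in> rules K"
  shows "{w \<in> space M. treatments \<X> (\<lambda>s. Y s w) t = z} \<in> sets M"
proof (induction t arbitrary: z)
  case (Suc t)
  show ?case
  proof (cases "z \<in> states K (Suc t)")
    case True
    then obtain z' x where z: "z = z' @ [x]" "z' \<in> states K t" "x \<in> {1..K}"
      by (auto simp: states_Suc)
    have "(\<lambda>w. restrict (\<lambda>s. Y s w) {1..<Suc t}) \<in> M \<rightarrow>\<^sub>M (\<Pi>\<^sub>M s\<in>{1..<Suc t}. borel)"
      by (intro measurable_restrict Y_measurable) simp
    moreover have "\<X> (Suc t) z' \<in> (\<Pi>\<^sub>M s\<in>{1..<Suc t}. borel) \<rightarrow>\<^sub>M count_space {1..K}"
      using rule_measurable[OF \<X> z(2)] .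
    ultimately have "(\<lambda>w. \<X> (Suc t) z' (restrict (\<lambda>s. Y s w) {1..<Suc t})) \<in> M \<rightarrow>\<^sub>M count_space {1..K}"
      by (rule measurable_compose)
    from measurable_sets[OF this, of "{x}"]
    have "{w \<in> space M. \<X> (Suc t) z' (restrict (\<lambda>s. Y s w) {1..<Suc t}) = x} \<in> sets M"
      using z by (simp add: vimage_def Int_def conj_commute)
    from sets.Int[OF Suc[of z'] this] show ?thesis
      unfolding z(1) by (rule back_subst[where P = "\<lambda>A. A \<in> sets M"]) auto
  next
    case False
    then have "{w \<in> space M. treatments \<X> (\<lambda>s. Y s w) (Suc t) = z} = {}"
      using treatments_in_states[OF \<X>] by blast
    then show ?thesis by (simp only: sets.empty_sets)
  qed
qed auto

lemma Theta_sets [measurable]: "{w \<in> space M. enat t < \<Theta> w} \<in> sets M"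
  using measurable_sets[OF Theta_measurable, of "{enat t<..}"] by (simp add: vimage_def Int_def conj_commute)

lemma X_sets:
  assumes \<X>: "\<X> \<in> rules K" and t: "1 \<le> t"
  shows "X t -` {x} \<inter> space M \<in> sets M"
proof -
  have "X t -` {x} \<inter> space M
      = (\<Union>z\<in>{z \<in> states K t. z ! (t - 1) = x}. {w \<in> space M. treatments \<X> (\<lambda>s. Y s w) t = z})"
    using treatments_in_states[OF \<X>] by (auto simp: X_def treatment_def)
  also have "\<dots> \<in> sets M"
    by (intro sets.finite_UN treatments_sets[OF \<X>]) simp
  finally show ?thesis .
qed

lemma past_generators:
  assumes "\<X> \<in> rules K"
  shows "{X s -` {x} \<inter> space M | s x. 1 \<le> s \<and> s \<le> t} \<union>
      {Y s -` B \<inter> space M | s B. 1 \<le> s \<and> s < t \<and> B \<in> sets borel} \<union>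
      {L s -` {i} \<inter> space M | s i. s \<in> J} \<subseteq> sets M"
proof -
  have "L s -` {i} \<inter> space M \<in> sets M" for s i
  proof -
    have "L s \<in> M \<rightarrow>\<^sub>M count_space UNIV"
      unfolding L_def by measurable
    then show ?thesis by (rule measurable_sets) simp
  qed
  then show ?thesis
    using X_sets[OF assms] measurable_sets[OF Y_measurable] by blast
qed

lemma space_past: "space (past M X Y L t J) = space M"
  unfolding past_def by (rule space_measure_of) blast

lemma past_X: "1 \<le> s \<Longrightarrow> s \<le> t \<Longrightarrow> X s -` {x} \<inter> space M \<in> sets (past M X Y L t J)"
  unfolding past_def by (rule in_measure_of) blast+

lemma past_L: "s \<in> J \<Longrightarrow> L s -` {i} \<inter> space M \<in> sets (past M X Y L t J)"
  unfolding past_def by (rule in_measure_of) blast+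

lemma past_subalgebra:
  assumes "\<X> \<in> rules K"
  shows "subalgebra M (past M X Y L t J)"
proof -
  have "sets (past M X Y L t J) \<subseteq> sets M"
    unfolding past_def using sets.sigma_sets_subset[OF past_generators[OF assms]]
    by (subst sets_measure_of) blast+
  then show ?thesis
    by (simp add: subalgebra_def space_past)
qed

lemma alive_Suc:
  assumes \<X>: "\<X> \<in> rules K"
  shows "alive (Suc t) (Suc t) z = ennreal (1 - \<pi> z) * alive t (Suc t) z"
proof -
  interpret prob_space M by (rule prob_space)
  let ?F = "past M X Y L (Suc t) {t}"
  let ?tr = "\<lambda>w. treatments \<X> (\<lambda>s. Y s w) (Suc t)"
  let ?A = "{w \<in> space M. enat t < \<Theta> w \<and> ?tr w = z}"
  let ?L = "{w \<in> space M. L (Suc t) w = 1}"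
  interpret F: finite_measure_subalgebra M ?F
    by unfold_locales (rule past_subalgebra[OF \<X>])
  have LS: "?L \<in> sets M"
  proof -
    have "?L = space M - {w \<in> space M. enat (Suc t) < \<Theta> w}" by (auto simp: L_def)
    then show ?thesis by simp
  qed
  have AM: "?A \<in> sets M"
    using sets.Int[OF Theta_sets[of t] treatments_sets[OF \<X>, of "Suc t" z]]
    by (rule back_subst[where P = "\<lambda>A. A \<in> sets M"]) auto
  have AF: "?A \<in> sets ?F"
  proof (cases "length z = Suc t")
    case True
    have "space M \<inter> (\<Inter>s\<in>{1..Suc t}. X s -` {z ! (s - 1)} \<inter> space M) \<in> sets ?F"
      unfolding space_past[of "Suc t" "{t}", symmetric]
      by (intro sets.Int sets.finite_INT sets.top past_X[unfolded space_past[of "Suc t" "{t}", symmetric]]) auto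
    moreover have "L t -` {0} \<inter> space M \<in> sets ?F"
      by (rule past_L) simp
    ultimately have "(L t -` {0} \<inter> space M) \<inter> (space M \<inter> (\<Inter>s\<in>{1..Suc t}. X s -` {z ! (s - 1)} \<inter> space M)) \<in> sets ?F"
      by blast
    also have "(L t -` {0} \<inter> space M) \<inter> (space M \<inter> (\<Inter>s\<in>{1..Suc t}. X s -` {z ! (s - 1)} \<inter> space M)) = ?A"
    proof -
      have "?tr w = z \<longleftrightarrow> (\<forall>s\<in>{1..Suc t}. X s w = z ! (s - 1))" for w
      proof -
        have "?tr w = z \<longleftrightarrow> (\<forall>i<Suc t. X (Suc i) w = z ! i)"
          unfolding treatments_seq_prefix list_eq_iff_nth_eq using True
          by (simp add: X_def nth_append del: upt_Suc)
        also have "\<dots> \<longleftrightarrow> (\<forall>s\<in>{1..Suc t}. X s w = z ! (s - 1))"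
          by (auto simp: all_conj_distrib) (metis Suc_le_mono Suc_pred less_Suc_eq_le less_eq_Suc_le)
        finally show ?thesis .
      qed
      then show ?thesis by (auto simp: L_def split: if_splits)
    qed
    finally show ?thesis .
  next
    case False
    then have "?A = {}" using length_treatments by auto
    then show ?thesis by (metis sets.empty_sets)
  qed
  have "measure M (?A \<inter> ?L) = (\<integral>w\<in>?A. indicator ?L w \<partial>M)"
    using AM LS by (simp add: set_lebesgue_integral_def indicator_inter_arith[symmetric] Int_ac)
  also have "\<dots> = (\<integral>w\<in>?A. real_cond_exp M ?F (indicator ?L) w \<partial>M)"
    using LS by (intro F.real_cond_exp_intA AF) (simp add: emeasure_eq_measure)
  also have "\<dots> = (\<integral>w. indicator ?A w * \<pi> z \<partial>M)"
    unfolding set_lebesgue_integral_def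
  proof (intro integral_cong_AE)
    show "AE w in M. indicator ?A w *\<^sub>R real_cond_exp M ?F (indicator ?L) w = indicator ?A w * \<pi> z"
    proof -
      have "AE w in M. L t w = 0 \<longrightarrow> real_cond_exp M ?F (indicator ?L) w = \<pi> (?tr w)"
        using transition[of "Suc t"] by simp
      then show ?thesis
      proof eventually_elim
        case (elim w)
        then show ?case by (cases "w \<in> ?A") (simp_all add: L_def del: treatments.simps)
      qed
    qed
    show "(\<lambda>w. indicator ?A w *\<^sub>R real_cond_exp M ?F (indicator ?L) w) \<in> borel_measurable M"
      using AM by measurable
  qed (use AM in measurable)
  also have "\<dots> = \<pi> z * measure M ?A"
    using AM by simp
  finally have "measure M (?A - ?L) = (1 - \<pi> z) * measure M ?A"
    using AM LS finite_measure_Diff'[of ?A ?L] by (simp add: algebra_simps)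
  moreover have "?A - ?L = {w \<in> space M. enat (Suc t) < \<Theta> w \<and> ?tr w = z}"
    by (auto simp: L_def elim: order_less_trans[rotated])
  ultimately show ?thesis
    unfolding alive_def emeasure_eq_measure by (simp add: ennreal_mult'')
qed

lemma alive_event:
  assumes "\<X> \<in> rules K"
  shows "{w \<in> space M. enat t < \<Theta> w \<and> treatments \<X> (\<lambda>s. Y s w) u = z} \<in> sets M"
  using sets.Int[OF Theta_sets[of t] treatments_sets[OF assms, of u z]]
  by (rule back_subst[where P = "\<lambda>A. A \<in> sets M"]) auto

lemma sum_alive:
  assumes \<X>: "\<X> \<in> rules K"
  shows "(\<Sum>z\<in>states K u. alive t u z) = emeasure M {w \<in> space M. enat t < \<Theta> w}"
proof -
  let ?A = "\<lambda>z. {w \<in> space M. enat t < \<Theta> w \<and> treatments \<X> (\<lambda>s. Y s w) u = z}"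
  have "disjoint_family_on ?A (states K u)"
    unfolding disjoint_family_on_def by blast
  then have "(\<Sum>z\<in>states K u. alive t u z) = emeasure M (\<Union>z\<in>states K u. ?A z)"
    unfolding alive_def using alive_event[OF \<X>] by (intro sum_emeasure) auto
  also have "(\<Union>z\<in>states K u. ?A z) = {w \<in> space M. enat t < \<Theta> w}"
    using treatments_in_states[OF \<X>] by blast
  finally show ?thesis .
qed

lemma alive_split:
  assumes \<X>: "\<X> \<in> rules K"
  shows "alive t u z = (\<Sum>x\<in>{1..K}. alive t (Suc u) (z @ [x]))"
proof -
  let ?A = "\<lambda>x. {w \<in> space M. enat t < \<Theta> w \<and> treatments \<X> (\<lambda>s. Y s w) (Suc u) = z @ [x]}"
  have "disjoint_family_on ?A {1..K}"
    unfolding disjoint_family_on_def by auto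
  then have "(\<Sum>x\<in>{1..K}. alive t (Suc u) (z @ [x])) = emeasure M (\<Union>x\<in>{1..K}. ?A x)"
    unfolding alive_def using alive_event[OF \<X>] by (intro sum_emeasure) blast+
  also have "(\<Union>x\<in>{1..K}. ?A x) = {w \<in> space M. enat t < \<Theta> w \<and> treatments \<X> (\<lambda>s. Y s w) u = z}"
    using rule_value[OF \<X> treatments_in_states[OF \<X>]] by auto
  finally show ?thesis
    by (simp only: alive_def)
qed

lemma alive_0: "alive 0 0 [] = ennreal (1 - \<pi> [])"
proof -
  interpret prob_space M by (rule prob_space)
  let ?L = "{w \<in> space M. L 0 w = 1}"
  have eq: "{w \<in> space M. enat 0 < \<Theta> w} = space M - ?L" by (auto simp: L_def)
  have "?L = space M - {w \<in> space M. enat 0 < \<Theta> w}" by (auto simp: L_def)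
  then have "?L \<in> sets M" by simp
  then have "measure M {w \<in> space M. enat 0 < \<Theta> w} = 1 - \<pi> []"
    unfolding eq using initial by (simp add: prob_compl)
  then show ?thesis by (simp add: alive_def emeasure_eq_measure)
qed

lemma mean_change_eq: "mean_change M \<Theta> = (\<Sum>t. emeasure M {w \<in> space M. enat t < \<Theta> w})"
  unfolding mean_change_def using nn_integral_enat_function[OF Theta_measurable] by simp


lemma horizon_value_le_sum:
  assumes \<X>: "\<X> \<in> rules K"
  shows "(\<Sum>z\<in>states K t. horizon_value K \<pi> n z * alive t t z)
    \<le> (\<Sum>i<n. emeasure M {w \<in> space M. enat (Suc t + i) < \<Theta> w})"
proof (induction n arbitrary: t)
  case (Suc n)
  let ?V = "horizon_value K \<pi>"
  have "(\<Sum>z\<in>states K t. ?V (Suc n) z * alive t t z)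
      = (\<Sum>z\<in>states K t. \<Sum>x\<in>{1..K}. ?V (Suc n) z * alive t (Suc t) (z @ [x]))"
    by (intro sum.cong refl, subst alive_split[OF \<X>]) (rule sum_distrib_left)
  also have "\<dots> \<le> (\<Sum>z\<in>states K t. \<Sum>x\<in>{1..K}.
      (ennreal (1 - \<pi> (z @ [x])) * (1 + ?V n (z @ [x]))) * alive t (Suc t) (z @ [x]))"
    by (intro sum_mono mult_right_mono horizon_value_Suc_le) auto
  also have "\<dots> = (\<Sum>z\<in>states K t. \<Sum>x\<in>{1..K}.
      (1 + ?V n (z @ [x])) * alive (Suc t) (Suc t) (z @ [x]))"
    by (simp only: alive_Suc[OF \<X>] mult_ac)
  also have "\<dots> = (\<Sum>z\<in>states K (Suc t). (1 + ?V n z) * alive (Suc t) (Suc t) z)"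
  proof -
    have inj: "inj_on (\<lambda>(z, x). z @ [x]) (states K t \<times> {1..K})"
      by (auto simp: inj_on_def)
    show ?thesis
      by (subst states_Suc, subst sum.reindex[OF inj])
        (simp only: sum.cartesian_product o_def case_prod_unfold)
  qed
  also have "\<dots> = emeasure M {w \<in> space M. enat (Suc t) < \<Theta> w}
      + (\<Sum>z\<in>states K (Suc t). ?V n z * alive (Suc t) (Suc t) z)"
    by (simp only: distrib_right sum.distrib mult_1 sum_alive[OF \<X>])
  also have "\<dots> \<le> emeasure M {w \<in> space M. enat (Suc t) < \<Theta> w}
      + (\<Sum>i<n. emeasure M {w \<in> space M. enat (Suc (Suc t) + i) < \<Theta> w})"
    by (intro add_left_mono Suc)
  also have "\<dots> = (\<Sum>i<Suc n. emeasure M {w \<in> space M. enat (Suc t + i) < \<Theta> w})"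
    by (simp add: sum.lessThan_Suc_shift del: sum.lessThan_Suc)
  finally show ?case .
qed simp

lemma mean_change_ge:
  assumes \<X>: "\<X> \<in> rules K"
  shows "ennreal (1 - \<pi> []) * (1 + (SUP n. horizon_value K \<pi> n [])) \<le> mean_change M \<Theta>"
proof -
  let ?p = "\<lambda>t. emeasure M {w \<in> space M. enat t < \<Theta> w}"
  have p0: "?p 0 = ennreal (1 - \<pi> [])"
    using alive_0 by (simp add: alive_def)
  have "ennreal (1 - \<pi> []) * (1 + horizon_value K \<pi> n []) \<le> mean_change M \<Theta>" for n
  proof -
    have "ennreal (1 - \<pi> []) * (1 + horizon_value K \<pi> n [])
        \<le> ?p 0 + (\<Sum>i<n. ?p (Suc i))"
    proof -
      have "ennreal (1 - \<pi> []) * horizon_value K \<pi> n [] \<le> (\<Sum>i<n. ?p (Suc i))"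
        using horizon_value_le_sum[OF \<X>, where t = 0 and n = n] by (simp add: alive_0 mult.commute)
      then show ?thesis
        unfolding p0 distrib_left mult_1_right by (rule add_left_mono)
    qed
    also have "\<dots> = (\<Sum>i<Suc n. ?p i)"
      by (simp add: sum.lessThan_Suc_shift del: sum.lessThan_Suc)
    also have "\<dots> \<le> mean_change M \<Theta>"
      unfolding mean_change_eq by (intro sum_le_suminf) auto
    finally show ?thesis .
  qed
  then have "(SUP n. ennreal (1 - \<pi> []) * (1 + horizon_value K \<pi> n [])) \<le> mean_change M \<Theta>"
    by (rule SUP_least)
  then show ?thesis
    by (simp add: SUP_mult_left_ennreal ennreal_SUP_add_right)
qed

lemma mean_change_open_loop_rule:
  assumes \<X>: "\<X> = open_loop_rule x" and x: "\<And>s. 1 \<le> s \<Longrightarrow> x s \<in> {1..K}"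
  shows "mean_change M \<Theta> = ennreal (1 - \<pi> []) * (1 + prod_series (\<lambda>s. ennreal (1 - \<pi> (seq_prefix x s))))"
proof -
  let ?p = "\<lambda>t. emeasure M {w \<in> space M. enat t < \<Theta> w}"
  let ?c = "\<lambda>s. ennreal (1 - \<pi> (seq_prefix x s))"
  have rules: "\<X> \<in> rules K"
    unfolding \<X> using x by (rule open_loop_rule_in_rules)
  have "treatments \<X> y u = seq_prefix x u" for y u
    unfolding \<X> by (rule treatments_open_loop_rule)
  then have alive: "alive t u (seq_prefix x u) = ?p t" for t u
    by (simp only: alive_def simp_thms)
  have "?p t = ennreal (1 - \<pi> []) * (\<Prod>s=1..t. ?c s)" for t
  proof (induction t)
    case 0
    then show ?case using alive_0 alive[of 0 0] by simp
  next
    case (Suc t)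
    have "?p (Suc t) = ?c (Suc t) * ?p t"
      using alive_Suc[OF rules, of t "seq_prefix x (Suc t)"] by (simp only: alive)
    then show ?case
      using Suc by (simp add: mult_ac)
  qed
  then have "mean_change M \<Theta> = ennreal (1 - \<pi> []) * (\<Sum>t. \<Prod>s=1..t. ?c s)"
    by (simp add: mean_change_eq)
  also have "(\<Sum>t. \<Prod>s=1..t. ?c s) = 1 + prod_series ?c"
    unfolding prod_series_def by (subst suminf_offset[of _ 1]) (simp_all add: add.commute)
  finally show ?thesis .
qed

end

section \<open>Finite memory and periodic blocks\<close>

lemma update_in_states: "x \<in> {1..K} \<Longrightarrow> S \<in> states K \<kappa> \<Longrightarrow> update \<kappa> x S \<in> states K \<kappa>"
  using set_take_subset[of \<kappa> "x # S"] by (auto simp: states_def update_def lists_eq_set)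

lemma state_after_snoc [simp]: "state_after \<kappa> S (z @ [x]) = update \<kappa> x (state_after \<kappa> S z)"
  by (simp add: state_after_def)

lemma state_after_Nil [simp]: "state_after \<kappa> S [] = S"
  by (simp add: state_after_def)

lemma state_after_in_states:
  "S \<in> states K \<kappa> \<Longrightarrow> z \<in> lists {1..K} \<Longrightarrow> state_after \<kappa> S z \<in> states K \<kappa>"
  by (induction z rule: rev_induct) (auto intro: update_in_states)

lemma state_after_eq_take:
  assumes "length S = \<kappa>"
  shows "state_after \<kappa> S z = take \<kappa> (rev z @ S)"
proof (induction z rule: rev_induct)
  case (snoc x z)
  then show ?case
    by (cases \<kappa>) (simp_all add: update_def min_def)
qed (use assms in simp)

lemma fm_hazard_Nil [simp]: "fm_hazard \<kappa> \<Psi> S p0 [] = p0"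
  by (simp add: fm_hazard_def)

lemma fm_hazard_snoc [simp]: "fm_hazard \<kappa> \<Psi> S p0 (z @ [x]) = \<Psi> x (state_after \<kappa> S z)"
  by (simp add: fm_hazard_def)

lemma open_loop_eq_state_after: "open_loop \<kappa> S x t = state_after \<kappa> S (seq_prefix x t)"
  by (induction t) simp_all

lemma fm_hazard_seq_prefix:
  "1 \<le> t \<Longrightarrow> fm_hazard \<kappa> \<Psi> S p0 (seq_prefix x t) = \<Psi> (x t) (open_loop \<kappa> S x (t - 1))"
  by (cases t) (simp_all add: open_loop_eq_state_after)

lemma seq_prefix_add: "seq_prefix x (k + s) = seq_prefix x k @ seq_prefix (\<lambda>i. x (k + i)) s"
  by (induction s) simp_all

lemma take_seq_prefix: "s \<le> t \<Longrightarrow> take s (seq_prefix x t) = seq_prefix x s"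
  by (simp add: take_map take_upt del: upt_Suc)

lemma cyc_add_mult: "cyc \<Xi> (i + int m * int (length \<Xi>)) = cyc \<Xi> i"
proof -
  have "i + int m * int (length \<Xi>) - 1 = (i - 1) + int m * int (length \<Xi>)"
    by simp
  then show ?thesis
    by (simp only: cyc_def mod_mult_self1)
qed

lemma opt_value_le:
  assumes x: "\<And>s. 1 \<le> s \<Longrightarrow> x s \<in> {1..K}"
  shows "ennreal (1 - \<Psi> (x 1) S) * (1 + opt_value K \<kappa> \<Psi> (update \<kappa> (x 1) S))
    \<le> prod_series (\<lambda>s. ennreal (1 - \<Psi> (x s) (open_loop \<kappa> S x (s - 1))))"
proof -
  let ?c = "\<lambda>s. ennreal (1 - \<Psi> (x s) (open_loop \<kappa> S x (s - 1)))"
  let ?x = "\<lambda>s. x (Suc s)"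
  have shift: "open_loop \<kappa> (update \<kappa> (x 1) S) ?x t = open_loop \<kappa> S x (Suc t)" for t
    by (induction t) simp_all
  have "opt_value K \<kappa> \<Psi> (update \<kappa> (x 1) S) \<le>
      prod_series (\<lambda>s. ennreal (1 - \<Psi> (?x s) (open_loop \<kappa> (update \<kappa> (x 1) S) ?x (s - 1))))"
    unfolding opt_value_def prod_series_def using x by (intro INF_lower) simp
  also have "\<dots> = prod_series (\<lambda>s. ?c (Suc s))"
    unfolding shift by (intro prod_series_cong) simp
  finally show ?thesis
    unfolding prod_series_shift[of ?c] by (auto intro!: mult_left_mono add_left_mono)
qed

locale stationary_policy =
  fixes K \<kappa> :: nat and \<upsilon> :: "nat list \<Rightarrow> nat" and S0 :: "nat list"
  assumes S0: "S0 \<in> states K \<kappa>"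
    and policy: "\<And>S. S \<in> states K \<kappa> \<Longrightarrow> \<upsilon> S \<in> {1..K}"
begin

abbreviation "St \<equiv> closed_loop \<kappa> \<upsilon> S0"
abbreviation "x \<equiv> policy_treatment \<kappa> \<upsilon> S0"
abbreviation "l \<equiv> loop_start St"
definition "p = loop_end St - l"
abbreviation "z0 \<equiv> policy_init \<kappa> \<upsilon> S0"
abbreviation "\<Xi> \<equiv> policy_block \<kappa> \<upsilon> S0"

lemma length_S0: "length S0 = \<kappa>"
  using S0 by (simp add: states_def)

lemma x_Suc: "x (Suc t) = \<upsilon> (St t)"
  by (simp add: policy_treatment_def)

lemma St_in_states: "St t \<in> states K \<kappa>"
  by (induction t) (simp_all only: closed_loop.simps S0 update_in_states policy)

lemma x_in: "1 \<le> t \<Longrightarrow> x t \<in> {1..K}"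
  using policy[OF St_in_states] by (simp add: policy_treatment_def)

lemma open_loop_x: "open_loop \<kappa> S0 x t = St t"
  by (induction t) (simp_all add: x_Suc)

lemma state_after_x: "state_after \<kappa> S0 (seq_prefix x t) = St t"
  using open_loop_x by (simp only: open_loop_eq_state_after)

lemma fm_hazard_x: "1 \<le> t \<Longrightarrow> fm_hazard \<kappa> \<Psi> S0 p0 (seq_prefix x t) = \<Psi> (x t) (St (t - 1))"
  by (simp only: fm_hazard_seq_prefix open_loop_x)

lemma ex_repetition: "\<exists>t. t \<le> card (states K \<kappa>) \<and> 1 \<le> t \<and> (\<exists>l<t. St t = St l)"
proof -
  let ?n = "card (states K \<kappa>)"
  have "card (St ` {..?n}) \<le> ?n"
    using St_in_states by (intro card_mono) auto
  then have "\<not> inj_on St {..?n}"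
    using card_image[of St "{..?n}"] by auto
  then obtain i j where "i \<le> ?n" "j \<le> ?n" "i \<noteq> j" "St i = St j"
    by (auto simp: inj_on_def)
  then consider "i < j" "j \<le> ?n" "St j = St i" | "j < i" "i \<le> ?n" "St i = St j"
    by (metis linorder_neqE_nat)
  then show ?thesis
    by cases (metis One_nat_def Suc_leI gr_zeroI not_less_zero)+
qed

lemma loop_end_repeats: "1 \<le> loop_end St" "\<exists>l<loop_end St. St (loop_end St) = St l"
  using ex_repetition LeastI_ex[of "\<lambda>t. 1 \<le> t \<and> (\<exists>l<t. St t = St l)"]
  unfolding loop_end_def by blast+

lemma loop_end_le: "loop_end St \<le> card (states K \<kappa>)"
proof -
  obtain t where "t \<le> card (states K \<kappa>)" "1 \<le> t \<and> (\<exists>l<t. St t = St l)"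
    using ex_repetition by blast
  then show ?thesis
    unfolding loop_end_def using Least_le[of "\<lambda>t. 1 \<le> t \<and> (\<exists>l<t. St t = St l)" t] by simp
qed

lemma loop_start: "l < loop_end St" "St l = St (loop_end St)"
proof -
  have "\<exists>!l. l < loop_end St \<and> St l = St (loop_end St)"
  proof (rule ex_ex1I)
    show "\<exists>l. l < loop_end St \<and> St l = St (loop_end St)"
      using loop_end_repeats(2) by metis
    have no_repeat: False if "i < j" "j < loop_end St" "St j = St i" for i j
    proof -
      have "\<not> (1 \<le> j \<and> (\<exists>l<j. St j = St l))"
        using that(2) unfolding loop_end_def by (rule not_less_Least)
      then show False using that(1,3) by auto
    qed
    fix i j
    assume "i < loop_end St \<and> St i = St (loop_end St)" "j < loop_end St \<and> St j = St (loop_end St)"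
    then show "i = j"
      using no_repeat by (metis linorder_neqE_nat)
  qed
  from theI'[OF this] show "l < loop_end St" "St l = St (loop_end St)"
    unfolding loop_start_def by blast+
qed

lemma period_pos: "0 < p"
  using loop_start(1) by (simp add: p_def)

lemma loop_end_eq: "loop_end St = l + p"
  using loop_start(1) by (simp add: p_def)

lemma St_period: "St (l + t + p) = St (l + t)"
proof (induction t)
  case 0
  then show ?case using loop_start(2) by (simp add: loop_end_eq)
next
  case (Suc t)
  then show ?case by (simp only: add_Suc add_Suc_right closed_loop.simps)
qed

lemma St_period_mult: "St (l + t + m * p) = St (l + t)"
proof (induction m)
  case (Suc m)
  have "l + t + Suc m * p = l + (t + m * p) + p"
    by simp
  then show ?case
    using Suc St_period[of "t + m * p"] by (simp only: add.assoc)
qed simp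

lemma x_period_mult: "x (l + Suc t + m * p) = x (l + Suc t)"
  using St_period_mult[of t m] by (simp add: x_Suc)

lemma length_block [simp]: "length \<Xi> = p"
  by (simp add: policy_block_def loop_end_eq)

lemma length_init [simp]: "length z0 = l"
  by (simp add: policy_init_def)

lemma cyc_block: "cyc \<Xi> (int (Suc i)) = x (l + Suc i)"
proof -
  have "i mod p < p"
    using period_pos by simp
  then have "cyc \<Xi> (int (Suc i)) = x (l + Suc (i mod p))"
    using length_block unfolding policy_block_def
    by (simp add: cyc_def loop_end_eq zmod_int[symmetric] del: upt_Suc)
  also have "\<dots> = x (l + Suc (i mod p) + (i div p) * p)"
    by (rule x_period_mult[symmetric])
  also have "l + Suc (i mod p) + (i div p) * p = l + Suc i"
    using mod_mult_div_eq[of i p] by (simp add: mult.commute)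
  finally show ?thesis .
qed

lemma block_prefix_eq: "block_prefix \<Xi> s = seq_prefix (\<lambda>i. x (l + i)) s"
  unfolding block_prefix_def
proof (rule map_cong)
  fix i assume "i \<in> set [1..<Suc s]"
  then obtain k where "i = Suc k"
    unfolding set_upt by (cases i) auto
  then show "cyc \<Xi> (int i) = x (l + i)"
    by (simp only: cyc_block)
qed simp

lemma init_append_block: "z0 @ block_prefix \<Xi> s = seq_prefix x (l + s)"
  unfolding block_prefix_eq seq_prefix_add policy_init_def ..

lemma block_state: "map (\<lambda>i. cyc \<Xi> (int (Suc j) - int i)) [1..<Suc \<kappa>] = St (l + j)"
proof (rule nth_equalityI)
  let ?t = "l + j + \<kappa> * p"
  have p: "\<kappa> \<le> \<kappa> * p"
    using period_pos by simp
  have "St (l + j) = St ?t"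
    by (rule St_period_mult[symmetric])
  also have "\<dots> = take \<kappa> (rev (seq_prefix x ?t) @ S0)"
    unfolding state_after_x[of ?t, symmetric] by (rule state_after_eq_take[OF length_S0])
  also have "\<dots> = take \<kappa> (rev (seq_prefix x ?t))"
  proof -
    have "\<kappa> \<le> ?t"
      using p by linarith
    then show ?thesis
      by (simp del: upt_Suc)
  qed
  finally have St: "St (l + j) = take \<kappa> (rev (seq_prefix x ?t))" .
  show "length (map (\<lambda>i. cyc \<Xi> (int (Suc j) - int i)) [1..<Suc \<kappa>]) = length (St (l + j))"
    using St_in_states by (simp add: states_def del: upt_Suc)
  fix i assume "i < length (map (\<lambda>i. cyc \<Xi> (int (Suc j) - int i)) [1..<Suc \<kappa>])"
  then have i: "i < \<kappa>" by (simp del: upt_Suc)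
  then have ip: "Suc i \<le> \<kappa> * p" using p by linarith
  have "map (\<lambda>i. cyc \<Xi> (int (Suc j) - int i)) [1..<Suc \<kappa>] ! i = cyc \<Xi> (int j - int i)"
    using i by (simp del: upt_Suc)
  also have "\<dots> = cyc \<Xi> (int j - int i + int \<kappa> * int (length \<Xi>))"
    by (rule cyc_add_mult[symmetric])
  also have "int j - int i + int \<kappa> * int (length \<Xi>) = int (Suc (j + \<kappa> * p - Suc i))"
    using ip by (simp add: of_nat_diff)
  also have "cyc \<Xi> \<dots> = x (l + Suc (j + \<kappa> * p - Suc i))"
    by (rule cyc_block)
  also have "l + Suc (j + \<kappa> * p - Suc i) = ?t - i"
    using ip by simp
  also have "x (?t - i) = take \<kappa> (rev (seq_prefix x ?t)) ! i"
    using i ip by (simp add: rev_nth Suc_diff_le[symmetric] Suc_diff_Suc del: upt_Suc)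
  finally show "map (\<lambda>i. cyc \<Xi> (int (Suc j) - int i)) [1..<Suc \<kappa>] ! i = St (l + j) ! i"
    unfolding St .
qed

lemma block_D_eq:
  "block_D I \<kappa> \<Psi> \<Xi> = (\<Sum>j<p. reward I \<Psi> (x (Suc (l + j))) (St (l + j))) / real p"
proof -
  have reindex: "(\<Sum>j=1..p. a j) = (\<Sum>j<p. a (Suc j))" for a :: "nat \<Rightarrow> real"
    by (rule sum.reindex_bij_witness[of _ Suc "\<lambda>j. j - 1"]) auto
  show ?thesis
    unfolding block_D_def block_info_def block_drift_def length_block reindex block_state cyc_block
      reward_def sum.distrib by (simp add: add_divide_distrib)
qed

lemma lambda_eq:
  "lambda \<pi> z0 \<Xi> = ennreal (1 - \<pi> []) * (1 + prod_series (\<lambda>s. ennreal (1 - \<pi> (seq_prefix x s))))"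
proof -
  let ?c = "\<lambda>s. ennreal (1 - \<pi> (seq_prefix x s))"
  have init: "(\<Prod>s=1..t. ennreal (1 - \<pi> (take s z0))) = prod ?c {1..t}" if "t \<le> l" for t
  proof (rule prod.cong)
    fix s assume "s \<in> {1..t}"
    then show "ennreal (1 - \<pi> (take s z0)) = ?c s"
      using that unfolding policy_init_def by (subst take_seq_prefix) auto
  qed simp
  have tail: "(\<Prod>s=l + 1..l + 1 + n. ennreal (1 - \<pi> (z0 @ block_prefix \<Xi> (s - l))))
      = (\<Prod>s=1..Suc n. ?c (l + s))" for n
    unfolding init_append_block
    by (rule prod.reindex_bij_witness[of _ "\<lambda>s. l + s" "\<lambda>s. s - l"]) auto
  have "(\<Sum>t=1..l. \<Prod>s=1..t. ennreal (1 - \<pi> (take s z0))) = (\<Sum>t=1..l. prod ?c {1..t})"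
    by (intro sum.cong init) auto
  then have "lambda \<pi> z0 \<Xi> = ennreal (1 - \<pi> []) *
      (1 + (\<Sum>t=1..l. prod ?c {1..t}) + prod ?c {1..l} * prod_series (\<lambda>s. ?c (l + s)))"
    unfolding lambda_def length_init Let_def tail init[OF order_refl]
    by (simp add: prod_series_def)
  then show ?thesis
    unfolding prod_series_split[of ?c l] by (simp only: add.assoc)
qed

lemma prod_series_le_opt_value:
  assumes "is_min_policy K \<kappa> \<Psi> \<upsilon>"
  shows "prod_series (\<lambda>s. ennreal (1 - \<Psi> (x s) (St (s - 1)))) \<le> opt_value K \<kappa> \<Psi> S0"
proof -
  have "prod_series (\<lambda>s. ennreal (1 - \<Psi> (x s) (St (s - 1)))) \<le> opt_value K \<kappa> \<Psi> (St 0)"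
  proof (rule prod_series_le_value)
    fix t
    show "ennreal (1 - \<Psi> (x (Suc t)) (St (Suc t - 1))) * (1 + opt_value K \<kappa> \<Psi> (St (Suc t)))
        \<le> opt_value K \<kappa> \<Psi> (St t)"
      unfolding opt_value_def[of K \<kappa> \<Psi> "St t"] prod_series_def[symmetric]
    proof (rule INF_greatest)
      fix y :: "nat \<Rightarrow> nat"
      assume y: "y \<in> {y. \<forall>s\<ge>1. y s \<in> {1..K}}"
      then have y1: "y 1 \<in> {1..K}" by blast
      have "is_arg_min (\<lambda>a. ennreal (1 - \<Psi> a (St t)) * (1 + opt_value K \<kappa> \<Psi> (update \<kappa> a (St t))))
          (\<lambda>a. a \<in> {1..K}) (x (Suc t))"
        using assms St_in_states unfolding is_min_policy_def x_Suc by blast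
      then have "ennreal (1 - \<Psi> (x (Suc t)) (St t)) * (1 + opt_value K \<kappa> \<Psi> (St (Suc t)))
          \<le> ennreal (1 - \<Psi> (y 1) (St t)) * (1 + opt_value K \<kappa> \<Psi> (update \<kappa> (y 1) (St t)))"
        using y1 unfolding is_arg_min_linorder closed_loop.simps x_Suc by blast
      also have "\<dots> \<le> prod_series (\<lambda>s. ennreal (1 - \<Psi> (y s) (open_loop \<kappa> (St t) y (s - 1))))"
        using y by (intro opt_value_le) blast
      finally show "ennreal (1 - \<Psi> (x (Suc t)) (St (Suc t - 1))) * (1 + opt_value K \<kappa> \<Psi> (St (Suc t)))
          \<le> prod_series (\<lambda>s. ennreal (1 - \<Psi> (y s) (open_loop \<kappa> (St t) y (s - 1))))"
        by simp
    qed
  qed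
  then show ?thesis by simp
qed

text \<open>After \<open>\<kappa>\<close> treatments from the block, the state no longer depends on the treatments before
  the block.\<close>

lemma lambda_tilde_le:
  assumes c: "0 < c" "c < 1"
    and hazard: "\<And>z. z \<in> lists {1..K} \<Longrightarrow> fm_hazard \<kappa> \<Psi> S0 p0 z \<in> {0..1 - c}"
  defines "\<pi> \<equiv> fm_hazard \<kappa> \<Psi> S0 p0"
  shows "ennreal (c ^ (\<kappa> + 1 + card (states K \<kappa>))) * lambda_tilde K \<pi> \<Xi> \<le> 1 + lambda \<pi> z0 \<Xi>"
proof -
  let ?c = "\<lambda>s. ennreal (1 - \<pi> (seq_prefix x s))"
  let ?N = "card (states K \<kappa>)"
  have lower: "ennreal c \<le> ennreal (1 - \<pi> z)" and upper: "ennreal (1 - \<pi> z) \<le> 1"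
    if "z \<in> lists {1..K}" for z
    using hazard[OF that] by (auto simp: \<pi>_def intro!: ennreal_leI)
  have x_lists: "seq_prefix (\<lambda>i. x (k + i)) t \<in> lists {1..K}" for k t
    using x_in by (fastforce simp: lists_eq_set)
  have c_pow: "ennreal (c ^ n) = ennreal c ^ n" for n
    using c by (simp add: ennreal_power)
  have c_le_1: "ennreal c ^ n \<le> 1" for n
    using c power_le_one[of c n] by (simp add: ennreal_power)

  have "ennreal c ^ \<kappa> * (\<Prod>s=1..Suc n. ennreal (1 - \<pi> (z @ block_prefix \<Xi> s)))
      \<le> (\<Prod>s=1..Suc n. ?c (l + s))" if z: "z \<in> lists {1..K}" for z n
  proof -
    let ?d = "\<lambda>s. if s \<le> \<kappa> then ennreal c else 1"
    have factor: "?d s * ennreal (1 - \<pi> (z @ block_prefix \<Xi> s)) \<le> ?c (l + s)" if s: "1 \<le> s" for s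
    proof (cases "s \<le> \<kappa>")
      case True
      have "ennreal c * ennreal (1 - \<pi> (z @ block_prefix \<Xi> s)) \<le> ennreal c * 1"
        using z x_lists unfolding block_prefix_eq by (intro mult_left_mono upper) auto
      also have "\<dots> \<le> ?c (l + s)"
        using lower[OF x_lists[of 0 "l + s"]] by simp
      finally show ?thesis using True by simp
    next
      case False
      then obtain r where r: "s = Suc r" "\<kappa> \<le> r"
        using s by (cases s) auto
      have "state_after \<kappa> S0 (y @ block_prefix \<Xi> r) = take \<kappa> (rev (block_prefix \<Xi> r))" for y
        unfolding state_after_eq_take[OF length_S0] block_prefix_eq using r by simp
      then have "\<pi> (z @ block_prefix \<Xi> s) = \<pi> (z0 @ block_prefix \<Xi> s)"
        unfolding \<pi>_def r block_prefix_eq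
        by (simp add: fm_hazard_snoc[of _ _ _ _ "_ @ _", simplified])
      then show ?thesis using False by (simp add: init_append_block)
    qed
    have "ennreal c ^ \<kappa> \<le> (\<Prod>s=1..Suc n. ?d s)"
    proof -
      have "(\<Prod>s=1..Suc n. ?d s) = ennreal c ^ card {s \<in> {1..Suc n}. s \<le> \<kappa>}"
        by (simp add: prod.If_cases Int_def del: prod.cl_ivl_Suc)
      moreover have "card {s \<in> {1..Suc n}. s \<le> \<kappa>} \<le> card {1..\<kappa>}"
        by (intro card_mono) auto
      ultimately show ?thesis
        using c by (simp add: ennreal_power power_decreasing ennreal_leI)
    qed
    then have "ennreal c ^ \<kappa> * (\<Prod>s=1..Suc n. ennreal (1 - \<pi> (z @ block_prefix \<Xi> s)))
        \<le> (\<Prod>s=1..Suc n. ?d s) * (\<Prod>s=1..Suc n. ennreal (1 - \<pi> (z @ block_prefix \<Xi> s)))"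
      by (rule mult_right_mono) simp
    also have "\<dots> \<le> (\<Prod>s=1..Suc n. ?c (l + s))"
      unfolding prod.distrib[symmetric] by (intro prod_mono_ennreal factor) simp
    finally show ?thesis .
  qed
  then have "ennreal c ^ \<kappa> * (\<Sum>n. \<Prod>s=1..Suc n. ennreal (1 - \<pi> (z @ block_prefix \<Xi> s)))
      \<le> prod_series (\<lambda>s. ?c (l + s))" if "z \<in> lists {1..K}" for z
    unfolding prod_series_def ennreal_suminf_cmult[symmetric] using that by (intro suminf_le) auto
  then have "ennreal c ^ \<kappa> * (1 + (\<Sum>n. \<Prod>s=1..Suc n. ennreal (1 - \<pi> (z @ block_prefix \<Xi> s))))
      \<le> 1 + prod_series (\<lambda>s. ?c (l + s))" if "z \<in> lists {1..K}" for z
    unfolding distrib_left using c_le_1 that by (intro add_mono) simp_all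
  then have "ennreal c ^ \<kappa> * lambda_tilde K \<pi> \<Xi> \<le> 1 + prod_series (\<lambda>s. ?c (l + s))"
    unfolding lambda_tilde_def by (subst SUP_mult_left_ennreal) (rule SUP_least)
  then have "ennreal c ^ (?N + 1) * (ennreal c ^ \<kappa> * lambda_tilde K \<pi> \<Xi>)
      \<le> ennreal c ^ (?N + 1) * (1 + prod_series (\<lambda>s. ?c (l + s)))"
    by (rule mult_left_mono) simp
  also have "\<dots> \<le> 1 + ennreal c ^ (?N + 1) * prod_series (\<lambda>s. ?c (l + s))"
    unfolding distrib_left mult_1_right by (intro add_right_mono c_le_1)
  also have "ennreal c ^ (?N + 1) * prod_series (\<lambda>s. ?c (l + s)) \<le> lambda \<pi> z0 \<Xi>"
  proof -
    have "ennreal c ^ ?N \<le> ennreal c ^ l"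
      using loop_start(1) loop_end_le c by (simp add: ennreal_power power_decreasing ennreal_leI)
    also have "\<dots> = (\<Prod>s=1..l. ennreal c)"
      by simp
    also have "\<dots> \<le> (\<Prod>s=1..l. ?c s)"
      using lower[OF x_lists[of 0]] unfolding add_0 by (intro prod_mono_ennreal)
    finally have "ennreal c ^ ?N * prod_series (\<lambda>s. ?c (l + s))
        \<le> (\<Prod>s=1..l. ?c s) * prod_series (\<lambda>s. ?c (l + s))"
      by (rule mult_right_mono) simp
    also have "\<dots> \<le> 1 + prod_series ?c"
      unfolding prod_series_split[of ?c l] by (simp add: add_increasing)
    finally have "ennreal c * (ennreal c ^ ?N * prod_series (\<lambda>s. ?c (l + s)))
        \<le> ennreal (1 - \<pi> []) * (1 + prod_series ?c)"
      using lower[of "[]"] by (intro mult_mono) auto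
    then show ?thesis
      unfolding lambda_eq by (simp add: mult.assoc)
  qed
  finally have "ennreal c ^ (?N + 1) * (ennreal c ^ \<kappa> * lambda_tilde K \<pi> \<Xi>) \<le> 1 + lambda \<pi> z0 \<Xi>"
    by (simp add: add_left_mono)
  moreover have "ennreal c ^ (?N + 1) * ennreal c ^ \<kappa> = ennreal (c ^ (\<kappa> + 1 + ?N))"
    unfolding c_pow power_add[symmetric] by (simp add: ac_simps)
  ultimately show ?thesis
    by (simp only: mult.assoc[symmetric])
qed

end

section \<open>Average rewards\<close>

lemma omega_nonneg [simp]: "0 \<le> omega q"
  by (simp add: omega_def)

lemma omega_le:
  assumes "0 < c" "0 \<le> q" "q \<le> 1 - c"
  shows "omega q \<le> - ln c"
  using assms by (simp add: omega_def)

lemma open_loop_in_states: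
  assumes "\<And>s. 1 \<le> s \<Longrightarrow> s \<le> n \<Longrightarrow> y s \<in> {1..K}" "S \<in> states K \<kappa>"
  shows "open_loop \<kappa> S y n \<in> states K \<kappa>"
  using assms by (induction n) (simp_all add: update_in_states)

lemma reward_sum_le:
  assumes eq: "average_reward_eq K \<kappa> I \<Psi> lam h" and S: "S \<in> states K \<kappa>"
    and y: "\<And>s. 1 \<le> s \<Longrightarrow> s \<le> n \<Longrightarrow> y s \<in> {1..K}"
  shows "(\<Sum>s<n. reward I \<Psi> (y (Suc s)) (open_loop \<kappa> S y s)) \<le> real n * lam + h S - h (open_loop \<kappa> S y n)"
  using y
proof (induction n)
  case (Suc n)
  let ?S = "open_loop \<kappa> S y n"
  have "?S \<in> states K \<kappa>"
    using Suc.prems S by (intro open_loop_in_states) simp_all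
  then have "lam + h ?S = Max ((\<lambda>x. reward I \<Psi> x ?S + h (update \<kappa> x ?S)) ` {1..K})"
    using eq unfolding average_reward_eq_def by blast
  moreover have "reward I \<Psi> (y (Suc n)) ?S + h (update \<kappa> (y (Suc n)) ?S)
      \<le> Max ((\<lambda>x. reward I \<Psi> x ?S + h (update \<kappa> x ?S)) ` {1..K})"
    using Suc.prems[of "Suc n"] by (intro Max_ge) auto
  moreover have "(\<Sum>s<n. reward I \<Psi> (y (Suc s)) (open_loop \<kappa> S y s)) \<le> real n * lam + h S - h ?S"
    using Suc by simp
  ultimately show ?case
    by (simp only: sum.lessThan_Suc open_loop.simps of_nat_Suc distrib_right mult_1)
qed simp

text \<open>Any state can be reached from any other in \<open>\<kappa>\<close> steps.\<close>

lemma relative_value_diff_le: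
  assumes eq: "average_reward_eq K \<kappa> I \<Psi> lam h" and I: "\<And>x. x \<in> {1..K} \<Longrightarrow> 0 \<le> I x"
    and S: "S \<in> states K \<kappa>" "S' \<in> states K \<kappa>"
  shows "h S' - h S \<le> real \<kappa> * lam"
proof -
  let ?y = "\<lambda>s. rev S' ! (s - 1)"
  have len: "length S = \<kappa>" "length S' = \<kappa>" and S': "set S' \<subseteq> {1..K}"
    using S by (auto simp: states_def)
  have y: "?y s \<in> {1..K}" if "1 \<le> s" "s \<le> \<kappa>" for s
  proof -
    have "?y s \<in> set (rev S')"
      using that len by (intro nth_mem) simp
    then show ?thesis using S' by auto
  qed
  have "seq_prefix ?y \<kappa> = rev S'"
    using len by (intro nth_equalityI) (simp_all del: upt_Suc)
  then have "open_loop \<kappa> S ?y \<kappa> = S'"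
    using len by (simp only: open_loop_eq_state_after state_after_eq_take) simp
  then have "(\<Sum>s<\<kappa>. reward I \<Psi> (?y (Suc s)) (open_loop \<kappa> S ?y s)) \<le> real \<kappa> * lam + h S - h S'"
    using reward_sum_le[OF eq S(1), of \<kappa> ?y] y by simp
  moreover have "0 \<le> (\<Sum>s<\<kappa>. reward I \<Psi> (?y (Suc s)) (open_loop \<kappa> S ?y s))"
    unfolding reward_def by (intro sum_nonneg add_nonneg_nonneg omega_nonneg I y) simp_all
  ultimately show ?thesis by linarith
qed

lemma rule_reward_sum_le:
  assumes eq: "average_reward_eq K \<kappa> I \<Psi> lam h" and I: "\<And>x. x \<in> {1..K} \<Longrightarrow> 0 \<le> I x"
    and S0: "S0 \<in> states K \<kappa>" and \<X>: "\<X> \<in> rules K"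
  shows "(\<Sum>s=1..n. I (treatment \<X> y (t + s)) + omega (fm_hazard \<kappa> \<Psi> S0 p0 (treatments \<X> y (t + s))))
    \<le> real (n + \<kappa>) * lam"
proof -
  let ?x = "treatment \<X> y" and ?S = "state_after \<kappa> S0 (treatments \<X> y t)"
  let ?y = "\<lambda>i. ?x (t + i)"
  have S: "?S \<in> states K \<kappa>"
    using treatments_in_states[OF \<X>] by (intro state_after_in_states S0) (simp add: states_def)
  have y: "?y s \<in> {1..K}" if "1 \<le> s" for s
    using that by (intro treatment_in \<X>) simp
  have state: "open_loop \<kappa> S0 ?x (t + s) = open_loop \<kappa> ?S ?y s" for s
    by (induction s) (simp_all add: open_loop_eq_state_after treatments_seq_prefix)
  have "I (?x (t + s)) + omega (fm_hazard \<kappa> \<Psi> S0 p0 (treatments \<X> y (t + s)))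
      = reward I \<Psi> (?y (Suc (s - 1))) (open_loop \<kappa> ?S ?y (s - 1))" if "1 \<le> s" for s
    using that unfolding reward_def treatments_seq_prefix[of \<X> y "t + s"]
    by (subst fm_hazard_seq_prefix) (simp_all add: state[symmetric])
  then have "(\<Sum>s=1..n. I (?x (t + s)) + omega (fm_hazard \<kappa> \<Psi> S0 p0 (treatments \<X> y (t + s))))
      = (\<Sum>s<n. reward I \<Psi> (?y (Suc s)) (open_loop \<kappa> ?S ?y s))"
    by (intro sum.reindex_bij_witness[of _ Suc "\<lambda>s. s - 1"]) auto
  also have "\<dots> \<le> real n * lam + h ?S - h (open_loop \<kappa> ?S ?y n)"
    by (intro reward_sum_le[OF eq S] y)
  also have "\<dots> \<le> real (n + \<kappa>) * lam"
    using relative_value_diff_le[OF eq I open_loop_in_states S, of n ?y] y S by (simp add: algebra_simps)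
  finally show ?thesis .
qed

context stationary_policy
begin

lemma block_D_eq_average:
  assumes eq: "average_reward_eq K \<kappa> I \<Psi> lam h" and max: "is_max_policy K \<kappa> I \<Psi> h \<upsilon>"
  shows "block_D I \<kappa> \<Psi> \<Xi> = lam"
proof -
  have step: "reward I \<Psi> (x (Suc t)) (St t) = lam - (h (St (Suc t)) - h (St t))" for t
  proof -
    let ?r = "\<lambda>a. reward I \<Psi> a (St t) + h (update \<kappa> a (St t))"
    have "is_arg_max ?r (\<lambda>a. a \<in> {1..K}) (x (Suc t))"
      using max St_in_states unfolding is_max_policy_def x_Suc by blast
    then have "Max (?r ` {1..K}) = ?r (x (Suc t))"
      unfolding is_arg_max_linorder by (intro Max_eqI) auto
    moreover have "lam + h (St t) = Max (?r ` {1..K})"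
      using eq St_in_states unfolding average_reward_eq_def by blast
    ultimately show ?thesis by (simp add: x_Suc)
  qed
  have "(\<Sum>j<p. reward I \<Psi> (x (Suc (l + j))) (St (l + j)))
      = real p * lam - (\<Sum>j<p. h (St (l + Suc j)) - h (St (l + j)))"
    unfolding step by (simp add: sum_subtractf)
  also have "(\<Sum>j<p. h (St (l + Suc j)) - h (St (l + j))) = h (St (l + p)) - h (St (l + 0))"
    by (rule sum_lessThan_telescope)
  also have "St (l + p) = St (l + 0)"
    using St_period[of 0] by simp
  finally show ?thesis
    using period_pos by (simp add: block_D_eq)
qed

lemma block_D_pos:
  assumes "\<And>x. x \<in> {1..K} \<Longrightarrow> 0 < I x"
  shows "0 < block_D I \<kappa> \<Psi> \<Xi>"
proof -
  have "0 < (\<Sum>j<p. reward I \<Psi> (x (Suc (l + j))) (St (l + j)))"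
    unfolding reward_def using assms x_in period_pos
    by (intro sum_pos add_pos_nonneg omega_nonneg) auto
  then show ?thesis
    using period_pos by (simp add: block_D_eq)
qed

lemma block_D_le:
  assumes c: "0 < c" and hazard: "\<And>z. z \<in> lists {1..K} \<Longrightarrow> fm_hazard \<kappa> \<Psi> S0 p0 z \<in> {0..1 - c}"
    and I: "\<And>x. x \<in> {1..K} \<Longrightarrow> 0 \<le> I x"
  shows "block_D I \<kappa> \<Psi> \<Xi> \<le> (\<Sum>x\<in>{1..K}. I x) - ln c"
proof -
  have "reward I \<Psi> (x (Suc t)) (St t) \<le> (\<Sum>x\<in>{1..K}. I x) - ln c" for t
  proof -
    have "I (x (Suc t)) \<le> (\<Sum>x\<in>{1..K}. I x)"
      using x_in[of "Suc t"] I by (intro member_le_sum) auto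
    moreover have "seq_prefix x (Suc t) \<in> lists {1..K}"
      using x_in unfolding lists_eq_set set_map set_upt by fastforce
    from hazard[OF this] have "\<Psi> (x (Suc t)) (St t) \<in> {0..1 - c}"
      by (simp only: fm_hazard_x) simp
    then have "omega (\<Psi> (x (Suc t)) (St t)) \<le> - ln c"
      using c by (intro omega_le) auto
    ultimately show ?thesis
      unfolding reward_def by simp
  qed
  then have "(\<Sum>j<p. reward I \<Psi> (x (Suc (l + j))) (St (l + j))) \<le> (\<Sum>j<p. (\<Sum>x\<in>{1..K}. I x) - ln c)"
    by (intro sum_mono)
  then show ?thesis
    using period_pos by (simp add: block_D_eq divide_le_eq mult.commute)
qed

lemma INF_mean_change_eq_lambda:
  fixes \<mu> :: "'y::polish_space measure" and M :: "'y rule \<Rightarrow> 'w measure"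
    and \<Psi> :: "nat \<Rightarrow> nat list \<Rightarrow> real" and p0 :: real
  defines "\<pi> \<equiv> fm_hazard \<kappa> \<Psi> S0 p0"
  assumes K: "1 \<le> K" and min: "is_min_policy K \<kappa> \<Psi> \<upsilon>"
    and process: "\<And>\<X>. \<X> \<in> rules K \<Longrightarrow> changepoint_process \<mu> f g \<pi> \<X> (M \<X>) (\<Theta> \<X>) (Y \<X>)"
  shows "(INF \<X>\<in>rules K. mean_change (M \<X>) (\<Theta> \<X>)) = lambda \<pi> z0 \<Xi>"
proof (rule antisym)
  have x_rule: "open_loop_rule x \<in> rules K"
    using x_in by (rule open_loop_rule_in_rules)
  have "mean_change (M (open_loop_rule x)) (\<Theta> (open_loop_rule x)) = lambda \<pi> z0 \<Xi>"
    unfolding lambda_eq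
    by (rule changepoint_process.mean_change_open_loop_rule[OF process[OF x_rule] refl x_in])
  then show "(INF \<X>\<in>rules K. mean_change (M \<X>) (\<Theta> \<X>)) \<le> lambda \<pi> z0 \<Xi>"
    using INF_lower[OF x_rule, of "\<lambda>\<X>. mean_change (M \<X>) (\<Theta> \<X>)"] by simp
  have "prod_series (\<lambda>s. ennreal (1 - \<pi> (seq_prefix x s))) \<le> (SUP n. horizon_value K \<pi> n [])"
  proof -
    obtain y where y: "\<And>s. y s \<in> {1..K}"
      and le: "prod_series (\<lambda>s. ennreal (1 - \<pi> (seq_prefix y s))) \<le> (SUP n. horizon_value K \<pi> n [])"
      using ex_sequence_le_limit_value[OF K] by blast
    have "prod_series (\<lambda>s. ennreal (1 - \<pi> (seq_prefix x s)))
        = prod_series (\<lambda>s. ennreal (1 - \<Psi> (x s) (St (s - 1))))"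
      unfolding \<pi>_def by (intro prod_series_cong) (simp only: fm_hazard_x)
    also have "\<dots> \<le> opt_value K \<kappa> \<Psi> S0"
      by (rule prod_series_le_opt_value[OF min])
    also have "\<dots> \<le> prod_series (\<lambda>s. ennreal (1 - \<Psi> (y s) (open_loop \<kappa> S0 y (s - 1))))"
      unfolding opt_value_def prod_series_def using y by (intro INF_lower) simp
    also have "\<dots> = prod_series (\<lambda>s. ennreal (1 - \<pi> (seq_prefix y s)))"
      unfolding \<pi>_def by (intro prod_series_cong) (simp only: fm_hazard_seq_prefix)
    finally show ?thesis using le by simp
  qed
  then have "lambda \<pi> z0 \<Xi> \<le> ennreal (1 - \<pi> []) * (1 + (SUP n. horizon_value K \<pi> n []))"
    unfolding lambda_eq by (intro mult_left_mono add_left_mono) simp_all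
  then show "lambda \<pi> z0 \<Xi> \<le> (INF \<X>\<in>rules K. mean_change (M \<X>) (\<Theta> \<X>))"
    using changepoint_process.mean_change_ge[OF process]
    by (intro INF_greatest) (blast intro: order_trans)
qed

end

section \<open>Asymptotics\<close>

lemma eventually_abs_ln_ge: "\<forall>\<^sub>F \<alpha> in at_right (0::real). \<alpha> \<in> {0<..<1} \<and> R \<le> \<bar>ln \<alpha>\<bar>"
proof -
  have "\<alpha> \<in> {0<..<1} \<and> R \<le> \<bar>ln \<alpha>\<bar>" if "0 < \<alpha>" "\<alpha> < min 1 (exp (- R))" for \<alpha> :: real
  proof -
    have "ln \<alpha> < - R"
      using that by (metis exp_less_cancel_iff exp_ln min_less_iff_conj)
    then show ?thesis using that by auto
  qed
  then show ?thesis
    by (subst eventually_at_right[of 0 1]) (auto intro!: exI[of _ "min 1 (exp (- R))"])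
qed

lemma ennreal_ratio_le:
  fixes a b :: ennreal
  assumes C: "0 < C" and le: "ennreal C * a \<le> 1 + b" and r: "1 \<le> r" and \<alpha>: "0 \<le> \<alpha>"
  shows "ennreal \<alpha> * a / (b + ennreal r) \<le> ennreal (\<alpha> / C)"
proof (rule divide_le_posI_ennreal)
  show "0 < b + ennreal r"
    using r by (simp add: add_pos_pos ennreal_less_zero_iff add_nonneg_pos)
  have "a = ennreal (1 / C) * (ennreal C * a)"
    using C by (simp add: mult.assoc[symmetric] ennreal_mult[symmetric])
  also have "\<dots> \<le> ennreal (1 / C) * (b + ennreal r)"
  proof (intro mult_left_mono)
    have "ennreal C * a \<le> 1 + b" by (rule le)
    also have "\<dots> \<le> ennreal r + b"
      using r by (intro add_right_mono) simp
    finally show "ennreal C * a \<le> b + ennreal r" by (simp add: add.commute)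
  qed simp
  finally have "ennreal \<alpha> * a \<le> ennreal \<alpha> * (ennreal (1 / C) * (b + ennreal r))"
    by (rule mult_left_mono) simp
  also have "\<dots> = (b + ennreal r) * ennreal (\<alpha> / C)"
    using C \<alpha> by (simp add: mult.assoc[symmetric] ennreal_mult[symmetric] mult.commute)
  finally show "ennreal \<alpha> * a \<le> (b + ennreal r) * ennreal (\<alpha> / C)" .
qed

theorem lemma6p2:
  fixes K \<kappa> :: nat and \<mu> :: "'y::polish_space measure" and f g :: "nat \<Rightarrow> 'y \<Rightarrow> real"
    and S0 :: "nat list" and \<Psi> :: "real \<Rightarrow> nat \<Rightarrow> nat list \<Rightarrow> real" and \<pi>0 :: "real \<Rightarrow> real"
    and M :: "real \<Rightarrow> 'y rule \<Rightarrow> 'w measure" and \<Theta> :: "real \<Rightarrow> 'y rule \<Rightarrow> 'w \<Rightarrow> enat"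
    and Y :: "real \<Rightarrow> 'y rule \<Rightarrow> nat \<Rightarrow> 'w \<Rightarrow> 'y"
    and \<upsilon>s \<upsilon>' :: "real \<Rightarrow> nat list \<Rightarrow> nat" and l' :: "real \<Rightarrow> real" and h' :: "real \<Rightarrow> nat list \<Rightarrow> real"
    and c :: real
  fixes \<pi> :: "real \<Rightarrow> nat list \<Rightarrow> real" and I :: "nat \<Rightarrow> real"
    and z0s \<Xi>1 \<Xi>2 :: "real \<Rightarrow> nat list" and lams :: "real \<Rightarrow> ennreal"
    and Ds :: "real \<Rightarrow> real" and N :: "real \<Rightarrow> real \<Rightarrow> nat"
  defines "\<pi> \<equiv> \<lambda>\<alpha>. fm_hazard \<kappa> (\<Psi> \<alpha>) S0 (\<pi>0 \<alpha>)"
    and "I \<equiv> info \<mu> f g"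
    and "z0s \<equiv> \<lambda>\<alpha>. policy_init \<kappa> (\<upsilon>s \<alpha>) S0"
    and "\<Xi>1 \<equiv> \<lambda>\<alpha>. policy_block \<kappa> (\<upsilon>s \<alpha>) S0"
    and "\<Xi>2 \<equiv> \<lambda>\<alpha>. policy_block \<kappa> (\<upsilon>' \<alpha>) S0"
    and "lams \<equiv> \<lambda>\<alpha>. INF \<X>\<in>rules K. mean_change (M \<alpha> \<X>) (\<Theta> \<alpha> \<X>)"
    and "Ds \<equiv> \<lambda>\<alpha>. block_D I \<kappa> (\<Psi> \<alpha>) (\<Xi>2 \<alpha>)"
    and "N \<equiv> \<lambda>\<epsilon> \<alpha>. nat \<lfloor>(1 - \<epsilon>) * \<bar>ln \<alpha>\<bar> / Ds \<alpha>\<rfloor>"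
  assumes K: "2 \<le> K"
    and response: "response_model K \<mu> f g"
    and S0: "S0 \<in> states K \<kappa>"
    and Psi: "\<And>\<alpha> x S. \<alpha> \<in> {0<..<1} \<Longrightarrow> x \<in> {1..K} \<Longrightarrow> S \<in> states K \<kappa> \<Longrightarrow> \<Psi> \<alpha> x S \<in> {0..<1}"
    and pi0: "\<And>\<alpha>. \<alpha> \<in> {0<..<1} \<Longrightarrow> \<pi>0 \<alpha> \<in> {0..<1}"
    and process: "\<And>\<alpha> \<X>. \<alpha> \<in> {0<..<1} \<Longrightarrow> \<X> \<in> rules K \<Longrightarrow>
      changepoint_process \<mu> f g (\<pi> \<alpha>) \<X> (M \<alpha> \<X>) (\<Theta> \<alpha> \<X>) (Y \<alpha> \<X>)"
    and c: "c \<in> {0<..<1}"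
    and hazard_bound: "\<forall>\<^sub>F \<alpha> in at_right 0. (SUP z\<in>lists {1..K}. \<pi> \<alpha> z) \<le> 1 - c"
    and min_policy: "\<And>\<alpha>. \<alpha> \<in> {0<..<1} \<Longrightarrow> is_min_policy K \<kappa> (\<Psi> \<alpha>) (\<upsilon>s \<alpha>)"
    and reward_eq: "\<And>\<alpha>. \<alpha> \<in> {0<..<1} \<Longrightarrow> average_reward_eq K \<kappa> I (\<Psi> \<alpha>) (l' \<alpha>) (h' \<alpha>)"
    and max_policy: "\<And>\<alpha>. \<alpha> \<in> {0<..<1} \<Longrightarrow> is_max_policy K \<kappa> I (\<Psi> \<alpha>) (h' \<alpha>) (\<upsilon>' \<alpha>)"
  shows "(\<forall>\<alpha>\<in>{0<..<1}. lams \<alpha> = lambda (\<pi> \<alpha>) (z0s \<alpha>) (\<Xi>1 \<alpha>)) \<and>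
    ((\<lambda>\<alpha>. ennreal \<alpha> * lambda_tilde K (\<pi> \<alpha>) (\<Xi>1 \<alpha>) / (lams \<alpha> + ennreal \<bar>ln \<alpha>\<bar>))
       \<longlongrightarrow> 0) (at_right 0) \<and>
    Ds \<in> O[at_right 0](\<lambda>_. 1) \<and>
    (\<forall>\<epsilon>\<in>{0<..<1}.
       Limsup (at_right 0) (\<lambda>\<alpha>.
         SUP t. SUP \<X>\<in>rules K. SUP w\<in>space (M \<alpha> \<X>).
           ereal (1 / (Ds \<alpha> * real (N \<epsilon> \<alpha>)) *
             (\<Sum>s=1..N \<epsilon> \<alpha>. I (treatment \<X> (\<lambda>r. Y \<alpha> \<X> r w) (t + s)) +
                omega (\<pi> \<alpha> (treatments \<X> (\<lambda>r. Y \<alpha> \<X> r w) (t + s))))))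
       \<le> ereal (1 + \<epsilon> / 2))"
proof -
  have K1: "1 \<le> K" using K by simp
  have I: "0 < I x" if "x \<in> {1..K}" for x
    unfolding I_def using response_model.info_pos[OF response that] .
  have I_nonneg: "0 \<le> I x" if "x \<in> {1..K}" for x
    using I[OF that] by simp
  have min_loop: "stationary_policy K \<kappa> (\<upsilon>s \<alpha>) S0" and max_loop: "stationary_policy K \<kappa> (\<upsilon>' \<alpha>) S0"
    if "\<alpha> \<in> {0<..<1}" for \<alpha>
    using S0 min_policy[OF that] max_policy[OF that]
    unfolding is_min_policy_def is_max_policy_def is_arg_min_def is_arg_max_def stationary_policy_def
    by blast+
  have lams: "lams \<alpha> = lambda (\<pi> \<alpha>) (z0s \<alpha>) (\<Xi>1 \<alpha>)" if \<alpha>: "\<alpha> \<in> {0<..<1}" for \<alpha>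
    unfolding lams_def z0s_def \<Xi>1_def \<pi>_def
    using process[OF \<alpha>] unfolding \<pi>_def
    by (rule stationary_policy.INF_mean_change_eq_lambda[OF min_loop[OF \<alpha>] K1 min_policy[OF \<alpha>]])

  have hazard: "\<pi> \<alpha> z \<in> {0..1 - c}"
    if \<alpha>: "\<alpha> \<in> {0<..<1}" and le: "(SUP z\<in>lists {1..K}. \<pi> \<alpha> z) \<le> 1 - c" and z: "z \<in> lists {1..K}" for \<alpha> z
  proof -
    have range: "\<pi> \<alpha> z \<in> {0..<1}" if "z \<in> lists {1..K}" for z
    proof (cases z rule: rev_cases)
      case (snoc y x)
      then show ?thesis
        using that Psi[OF \<alpha>, of x "state_after \<kappa> S0 y"] state_after_in_states[OF S0, of y]
        by (simp add: \<pi>_def)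
    qed (use pi0[OF \<alpha>] in \<open>simp add: \<pi>_def\<close>)
    then have "bdd_above (\<pi> \<alpha> ` lists {1..K})"
      by (intro bdd_aboveI[of _ 1]) fastforce
    then have "\<pi> \<alpha> z \<le> (SUP z\<in>lists {1..K}. \<pi> \<alpha> z)"
      using z by (intro cSUP_upper)
    then show ?thesis using le range[OF z] by simp
  qed
  have eventually_large: "\<forall>\<^sub>F \<alpha> in at_right 0. \<alpha> \<in> {0<..<1} \<and> R \<le> \<bar>ln \<alpha>\<bar> \<and>
      (\<forall>z\<in>lists {1..K}. \<pi> \<alpha> z \<in> {0..1 - c})" for R
    using eventually_abs_ln_ge[of R] hazard_bound by eventually_elim (use hazard in blast)

  define C where "C = c ^ (\<kappa> + 1 + card (states K \<kappa>))"
  have C: "0 < C" using c by (simp add: C_def)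
  have tilde: "\<forall>\<^sub>F \<alpha> in at_right 0.
      ennreal \<alpha> * lambda_tilde K (\<pi> \<alpha>) (\<Xi>1 \<alpha>) / (lams \<alpha> + ennreal \<bar>ln \<alpha>\<bar>) \<le> ennreal (\<alpha> / C)"
    using eventually_large[of 1]
  proof eventually_elim
    case (elim \<alpha>)
    then have \<alpha>: "\<alpha> \<in> {0<..<1}" and ln: "1 \<le> \<bar>ln \<alpha>\<bar>"
      and hz: "\<And>z. z \<in> lists {1..K} \<Longrightarrow> fm_hazard \<kappa> (\<Psi> \<alpha>) S0 (\<pi>0 \<alpha>) z \<in> {0..1 - c}"
      unfolding \<pi>_def by blast+
    have "ennreal C * lambda_tilde K (\<pi> \<alpha>) (\<Xi>1 \<alpha>) \<le> 1 + lams \<alpha>"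
      unfolding lams[OF \<alpha>] C_def unfolding \<pi>_def \<Xi>1_def z0s_def
      using c by (intro stationary_policy.lambda_tilde_le[OF min_loop[OF \<alpha>] _ _ hz]) auto
    then show ?case
      using C ln \<alpha> by (intro ennreal_ratio_le) auto
  qed
  have "((\<lambda>\<alpha>. \<alpha> / C) \<longlongrightarrow> 0 / C) (at_right 0)"
    using C by (intro tendsto_intros) simp_all
  then have "((\<lambda>\<alpha>. ennreal (\<alpha> / C)) \<longlongrightarrow> 0) (at_right 0)"
    using tendsto_ennrealI by fastforce
  then have a: "((\<lambda>\<alpha>. ennreal \<alpha> * lambda_tilde K (\<pi> \<alpha>) (\<Xi>1 \<alpha>) / (lams \<alpha> + ennreal \<bar>ln \<alpha>\<bar>))
      \<longlongrightarrow> 0) (at_right 0)"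
    by (rule tendsto_sandwich[OF _ tilde tendsto_const, rotated]) simp

  define B where "B = (\<Sum>x\<in>{1..K}. I x) - ln c"
  have Ds: "0 < Ds \<alpha>" "Ds \<alpha> \<le> B" "Ds \<alpha> = l' \<alpha>"
    if \<alpha>: "\<alpha> \<in> {0<..<1}" and hz: "\<forall>z\<in>lists {1..K}. \<pi> \<alpha> z \<in> {0..1 - c}" for \<alpha>
  proof -
    interpret stationary_policy K \<kappa> "\<upsilon>' \<alpha>" S0
      by (rule max_loop[OF \<alpha>])
    show "0 < Ds \<alpha>"
      unfolding Ds_def \<Xi>2_def using I by (rule block_D_pos)
    show "Ds \<alpha> \<le> B"
      unfolding Ds_def \<Xi>2_def B_def using c hz unfolding \<pi>_def
      by (intro block_D_le[of c _ "\<pi>0 \<alpha>"] I_nonneg) auto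
    show "Ds \<alpha> = l' \<alpha>"
      unfolding Ds_def \<Xi>2_def by (rule block_D_eq_average[OF reward_eq[OF \<alpha>] max_policy[OF \<alpha>]])
  qed
  have bigo: "Ds \<in> O[at_right 0](\<lambda>_. 1)"
  proof (rule bigoI)
    show "\<forall>\<^sub>F \<alpha> in at_right 0. norm (Ds \<alpha>) \<le> B * norm (1::real)"
      using eventually_large[of 1]
    proof eventually_elim
      case (elim \<alpha>)
      then have "0 < Ds \<alpha>" "Ds \<alpha> \<le> B"
        using Ds by blast+
      then show ?case by simp
    qed
  qed

  have "Limsup (at_right 0) (\<lambda>\<alpha>. SUP t. SUP \<X>\<in>rules K. SUP w\<in>space (M \<alpha> \<X>).
           ereal (1 / (Ds \<alpha> * real (N \<epsilon> \<alpha>)) *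
             (\<Sum>s=1..N \<epsilon> \<alpha>. I (treatment \<X> (\<lambda>r. Y \<alpha> \<X> r w) (t + s)) +
                omega (\<pi> \<alpha> (treatments \<X> (\<lambda>r. Y \<alpha> \<X> r w) (t + s))))))
       \<le> ereal (1 + \<epsilon> / 2)" if \<epsilon>: "\<epsilon> \<in> {0<..<1}" for \<epsilon>
  proof (rule Limsup_bounded)
    define m where "m = 2 * real \<kappa> / \<epsilon> + 1"
    have m: "1 \<le> m" "real \<kappa> \<le> \<epsilon> / 2 * m"
      using \<epsilon> by (simp_all add: m_def field_simps)
    show "\<forall>\<^sub>F \<alpha> in at_right 0. (SUP t. SUP \<X>\<in>rules K. SUP w\<in>space (M \<alpha> \<X>).
           ereal (1 / (Ds \<alpha> * real (N \<epsilon> \<alpha>)) *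
             (\<Sum>s=1..N \<epsilon> \<alpha>. I (treatment \<X> (\<lambda>r. Y \<alpha> \<X> r w) (t + s)) +
                omega (\<pi> \<alpha> (treatments \<X> (\<lambda>r. Y \<alpha> \<X> r w) (t + s))))))
       \<le> ereal (1 + \<epsilon> / 2)"
      using eventually_large[of "B * (m + 1) / (1 - \<epsilon>)"]
    proof eventually_elim
      case (elim \<alpha>)
      then have \<alpha>: "\<alpha> \<in> {0<..<1}" and ln: "B * (m + 1) / (1 - \<epsilon>) \<le> \<bar>ln \<alpha>\<bar>"
        and hz: "\<forall>z\<in>lists {1..K}. \<pi> \<alpha> z \<in> {0..1 - c}"
        by blast+
      note D = Ds[OF \<alpha> hz]
      have "Ds \<alpha> * (m + 1) \<le> B * (m + 1)"
        using D m by (intro mult_right_mono) auto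
      also have "\<dots> \<le> (1 - \<epsilon>) * \<bar>ln \<alpha>\<bar>"
        using ln \<epsilon> by (simp add: divide_le_eq mult.commute)
      finally have "m + 1 \<le> (1 - \<epsilon>) * \<bar>ln \<alpha>\<bar> / Ds \<alpha>"
        using D by (simp add: le_divide_eq mult.commute)
      then have N: "m \<le> real (N \<epsilon> \<alpha>)"
        unfolding N_def using m by linarith
      show ?case
      proof (intro SUP_least)
        fix t w and \<X> :: "'y rule"
        assume \<X>: "\<X> \<in> rules K"
        let ?y = "\<lambda>r. Y \<alpha> \<X> r w" and ?N = "real (N \<epsilon> \<alpha>)"
        have "1 / (Ds \<alpha> * ?N) * (\<Sum>s=1..N \<epsilon> \<alpha>. I (treatment \<X> ?y (t + s)) + omega (\<pi> \<alpha> (treatments \<X> ?y (t + s))))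
            \<le> 1 / (Ds \<alpha> * ?N) * (real (N \<epsilon> \<alpha> + \<kappa>) * Ds \<alpha>)"
          unfolding D(3) \<pi>_def using D N m
          by (intro mult_left_mono rule_reward_sum_le[OF reward_eq[OF \<alpha>] I_nonneg S0 \<X>]) simp_all
        also have "\<dots> = 1 + real \<kappa> / ?N"
          using D N m by (simp add: field_simps)
        also have "\<dots> \<le> 1 + \<epsilon> / 2"
        proof -
          have "real \<kappa> \<le> \<epsilon> / 2 * ?N"
            using m(2) N \<epsilon> by (meson mult_left_mono order_trans less_imp_le half_gt_zero greaterThanLessThan_iff)
          then show ?thesis
            using N m by (simp add: divide_le_eq)
        qed
        finally show "ereal (1 / (Ds \<alpha> * ?N) * (\<Sum>s=1..N \<epsilon> \<alpha>. I (treatment \<X> ?y (t + s)) + omega (\<pi> \<alpha> (treatments \<X> ?y (t + s)))))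
            \<le> ereal (1 + \<epsilon> / 2)"
          by simp
      qed
    qed
  qed
  then show ?thesis
    using lams a bigo by blast
qed

end
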